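(* Let $(\Omega,\Sigma,\mu)$ be a measure space and let $\Gamma$ be any set. Then $$\mathrm{NA}_\pi(L_1(\mu)\widehat{\otimes}_\pi c_0(\Gamma))=L_1(\mu)\widehat{\otimes}_\pi c_0(\Gamma).$$
   Context: All Banach spaces are real; $c_0(\Gamma)$ is the space of functions $x:\Gamma\to\mathbb R$ such that $\{\gamma:|x(\gamma)|>\varepsilon\}$ is finite for every $\varepsilon>0$, with the supremum norm. $X\widehat{\otimes}_\pi Y$ denotes the projective tensor product. An element $u\in X\widehat{\otimes}_\pi Y$ attains its projective norm if there are $(x_i)\subseteq X$, $(y_i)\subseteq Y$ with $u=\sum_{i=1}^\infty x_i\otimes y_i$ and $\|u\|_\pi=\sum_{i=1}^\infty\|x_i\|\|y_i\|$; $\mathrm{NA}_\pi(X\widehat{\otimes}_\pi Y)$ is the set of such elements. *)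

theory Defs
  imports "HOL-Analysis.Analysis"
begin

text \<open>
  The space \<open>L\<^sub>1(\<mu>)\<close> depends on a measure, i.e. on a term, so it cannot be
  a type of class \<^class>\<open>banach\<close>. Normed real vector spaces are therefore given by an explicit
  carrier together with their operations. The operations are only meaningful on the carrier.
\<close>

record 'v normed_vs =
  vcarrier :: "'v set"
  vzero :: 'v
  vadd :: "'v \<Rightarrow> 'v \<Rightarrow> 'v"
  vscale :: "real \<Rightarrow> 'v \<Rightarrow> 'v"
  vnorm :: "'v \<Rightarrow> real"

definition vdist :: "'v normed_vs \<Rightarrow> 'v \<Rightarrow> 'v \<Rightarrow> real" where
  "vdist V u v = vnorm V (vadd V u (vscale V (- 1) v))"

primrec vsum :: "'v normed_vs \<Rightarrow> (nat \<Rightarrow> 'v) \<Rightarrow> nat \<Rightarrow> 'v" where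
  "vsum V f 0 = vzero V"
| "vsum V f (Suc n) = vadd V (vsum V f n) (f n)"

definition vsums :: "'v normed_vs \<Rightarrow> (nat \<Rightarrow> 'v) \<Rightarrow> 'v \<Rightarrow> bool" where
  "vsums V f u \<longleftrightarrow> (\<lambda>n. vdist V (vsum V f n) u) \<longlonglongrightarrow> 0"


section \<open>The spaces \<open>L\<^sub>1(\<mu>)\<close> and \<open>c\<^sub>0(\<Gamma>)\<close>\<close>

definition L1_class :: "'a measure \<Rightarrow> ('a \<Rightarrow> real) \<Rightarrow> ('a \<Rightarrow> real) set" where
  "L1_class M f = {g. integrable M g \<and> (AE t in M. f t = g t)}"

definition L1_rep :: "('a \<Rightarrow> real) set \<Rightarrow> 'a \<Rightarrow> real" where
  "L1_rep F = (SOME f. f \<in> F)"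

definition L1 :: "'a measure \<Rightarrow> ('a \<Rightarrow> real) set normed_vs" where
  "L1 M = \<lparr>
     vcarrier = L1_class M ` {f. integrable M f},
     vzero = L1_class M (\<lambda>t. 0),
     vadd = (\<lambda>F G. L1_class M (\<lambda>t. L1_rep F t + L1_rep G t)),
     vscale = (\<lambda>c F. L1_class M (\<lambda>t. c * L1_rep F t)),
     vnorm = (\<lambda>F. \<integral>t. \<bar>L1_rep F t\<bar> \<partial>M) \<rparr>"

text \<open>
  Functions on \<open>\<Gamma>\<close> are extended by \<open>0\<close> outside \<open>\<Gamma>\<close>. This does not change the supremum norm
  and makes the norm of the only element equal to \<open>0\<close> when \<open>\<Gamma>\<close> is empty.
\<close>

definition c0 :: "'g set \<Rightarrow> ('g \<Rightarrow> real) normed_vs" where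
  "c0 \<Gamma> = \<lparr>
     vcarrier = {x. (\<forall>\<gamma>. \<gamma> \<notin> \<Gamma> \<longrightarrow> x \<gamma> = 0) \<and> (\<forall>\<epsilon>>0. finite {\<gamma> \<in> \<Gamma>. \<bar>x \<gamma>\<bar> > \<epsilon>})},
     vzero = (\<lambda>\<gamma>. 0),
     vadd = (\<lambda>x y \<gamma>. x \<gamma> + y \<gamma>),
     vscale = (\<lambda>c x \<gamma>. c * x \<gamma>),
     vnorm = (\<lambda>x. SUP \<gamma>. \<bar>x \<gamma>\<bar>) \<rparr>"


section \<open>The algebraic tensor product with the projective norm\<close>

definition bilinear_form :: "'x normed_vs \<Rightarrow> 'y normed_vs \<Rightarrow> ('x \<Rightarrow> 'y \<Rightarrow> real) \<Rightarrow> bool" where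
  "bilinear_form X Y B \<longleftrightarrow>
     (\<forall>x\<in>vcarrier X. \<forall>x'\<in>vcarrier X. \<forall>y\<in>vcarrier Y. B (vadd X x x') y = B x y + B x' y) \<and>
     (\<forall>x\<in>vcarrier X. \<forall>y\<in>vcarrier Y. \<forall>y'\<in>vcarrier Y. B x (vadd Y y y') = B x y + B x y') \<and>
     (\<forall>c. \<forall>x\<in>vcarrier X. \<forall>y\<in>vcarrier Y. B (vscale X c x) y = c * B x y) \<and>
     (\<forall>c. \<forall>x\<in>vcarrier X. \<forall>y\<in>vcarrier Y. B x (vscale Y c y) = c * B x y)"

text \<open>
  As usual, the algebraic tensor product is realised inside the linear functionals on the space of
  all (not necessarily bounded) bilinear forms, \<open>x \<otimes> y\<close> being evaluation at \<open>(x, y)\<close>. The value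
  \<open>0\<close> at arguments that are not bilinear forms is a dummy.
\<close>

type_synonym ('x, 'y) tensor = "('x \<Rightarrow> 'y \<Rightarrow> real) \<Rightarrow> real"

definition elem_tensor ::
  "'x normed_vs \<Rightarrow> 'y normed_vs \<Rightarrow> 'x \<Rightarrow> 'y \<Rightarrow> ('x, 'y) tensor" where
  "elem_tensor X Y x y = (\<lambda>B. if bilinear_form X Y B then B x y else 0)"

definition finite_rep ::
  "'x normed_vs \<Rightarrow> 'y normed_vs \<Rightarrow> nat \<Rightarrow> (nat \<Rightarrow> 'x) \<Rightarrow> (nat \<Rightarrow> 'y) \<Rightarrow> ('x, 'y) tensor \<Rightarrow> bool" where
  "finite_rep X Y n x y u \<longleftrightarrow>
     (\<forall>i<n. x i \<in> vcarrier X \<and> y i \<in> vcarrier Y) \<and>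
     u = (\<lambda>B. \<Sum>i<n. elem_tensor X Y (x i) (y i) B)"

definition alg_tensor :: "'x normed_vs \<Rightarrow> 'y normed_vs \<Rightarrow> ('x, 'y) tensor normed_vs" where
  "alg_tensor X Y = \<lparr>
     vcarrier = {u. \<exists>n x y. finite_rep X Y n x y u},
     vzero = (\<lambda>B. 0),
     vadd = (\<lambda>u v B. u B + v B),
     vscale = (\<lambda>c u B. c * u B),
     vnorm = (\<lambda>u. Inf {\<Sum>i<n. vnorm X (x i) * vnorm Y (y i) | n x y. finite_rep X Y n x y u}) \<rparr>"


section \<open>Completion by Cauchy sequences\<close>

definition cauchy_seqs :: "'v normed_vs \<Rightarrow> (nat \<Rightarrow> 'v) set" where
  "cauchy_seqs V = {s. (\<forall>n. s n \<in> vcarrier V) \<and>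
     (\<forall>\<epsilon>>0. \<exists>N. \<forall>m\<ge>N. \<forall>n\<ge>N. vdist V (s m) (s n) < \<epsilon>)}"

definition cauchy_class :: "'v normed_vs \<Rightarrow> (nat \<Rightarrow> 'v) \<Rightarrow> (nat \<Rightarrow> 'v) set" where
  "cauchy_class V s = {t \<in> cauchy_seqs V. (\<lambda>n. vdist V (s n) (t n)) \<longlonglongrightarrow> 0}"

definition cauchy_rep :: "(nat \<Rightarrow> 'v) set \<Rightarrow> nat \<Rightarrow> 'v" where
  "cauchy_rep S = (SOME s. s \<in> S)"

definition completion :: "'v normed_vs \<Rightarrow> (nat \<Rightarrow> 'v) set normed_vs" where
  "completion V = \<lparr>
     vcarrier = cauchy_class V ` cauchy_seqs V,
     vzero = cauchy_class V (\<lambda>n. vzero V),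
     vadd = (\<lambda>S T. cauchy_class V (\<lambda>n. vadd V (cauchy_rep S n) (cauchy_rep T n))),
     vscale = (\<lambda>c S. cauchy_class V (\<lambda>n. vscale V c (cauchy_rep S n))),
     vnorm = (\<lambda>S. lim (\<lambda>n. vnorm V (cauchy_rep S n))) \<rparr>"


section \<open>The projective tensor product and norm attainment\<close>

type_synonym ('x, 'y) proj_tensor = "(nat \<Rightarrow> ('x, 'y) tensor) set"

definition proj_tensor_product ::
  "'x normed_vs \<Rightarrow> 'y normed_vs \<Rightarrow> ('x, 'y) proj_tensor normed_vs" where
  "proj_tensor_product X Y = completion (alg_tensor X Y)"

definition proj_elem_tensor ::
  "'x normed_vs \<Rightarrow> 'y normed_vs \<Rightarrow> 'x \<Rightarrow> 'y \<Rightarrow> ('x, 'y) proj_tensor" where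
  "proj_elem_tensor X Y x y = cauchy_class (alg_tensor X Y) (\<lambda>n. elem_tensor X Y x y)"

definition attains_proj_norm ::
  "'x normed_vs \<Rightarrow> 'y normed_vs \<Rightarrow> ('x, 'y) proj_tensor \<Rightarrow> bool" where
  "attains_proj_norm X Y u \<longleftrightarrow>
     (\<exists>x y. (\<forall>i. x i \<in> vcarrier X) \<and> (\<forall>i. y i \<in> vcarrier Y) \<and>
        vsums (proj_tensor_product X Y) (\<lambda>i. proj_elem_tensor X Y (x i) (y i)) u \<and>
        (\<lambda>i. vnorm X (x i) * vnorm Y (y i)) sums vnorm (proj_tensor_product X Y) u)"

definition NA_proj :: "'x normed_vs \<Rightarrow> 'y normed_vs \<Rightarrow> ('x, 'y) proj_tensor set" where
  "NA_proj X Y = {u \<in> vcarrier (proj_tensor_product X Y). attains_proj_norm X Y u}"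

end

theory Submission
  imports Defs
begin

text \<open>
  The projective norm on \<open>L\<^sub>1(\<mu>) \<otimes> c\<^sub>0(\<Gamma>)\<close> is the norm of \<open>L\<^sub>1(\<mu>; c\<^sub>0(\<Gamma>))\<close>, so a tensor is an integrable
  function \<open>G\<close> with values in \<open>c\<^sub>0(\<Gamma>)\<close>. For \<open>x\<close> in \<open>c\<^sub>0(\<Gamma>)\<close> and \<open>s > 0\<close> let \<open>level x s\<close> be the vector
  \<open>1\<^bsub>{x > s}\<^esub> - 1\<^bsub>{x < -s}\<^esub>\<close>. It has finite support and entries in \<open>{-1, 0, 1}\<close>, hence takes only
  countably many values when \<open>x\<close> has its support in a fixed countable set, and \<open>x\<close> is the integral of
  \<open>level x s\<close> over \<open>s > 0\<close>. Grouping this integral by the values \<open>y\<^sub>i\<close> gives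
  \<open>G(t) = \<Sum>\<^sub>i g\<^sub>i(t) y\<^sub>i\<close> with \<open>g\<^sub>i(t) = |{s. level (G t) s = y\<^sub>i}|\<close>. The level sets of the
  nonzero \<open>y\<^sub>i\<close> partition the interval from \<open>0\<close> to \<open>\<parallel>G(t)\<parallel>\<close>, so \<open>\<Sum>\<^sub>i g\<^sub>i(t) = \<parallel>G(t)\<parallel>\<close> and
  \<open>\<Sum>\<^sub>i g\<^sub>i \<otimes> y\<^sub>i\<close> attains the norm.

  The same finite decomposition bounds the projective norm of a finitely supported \<open>F\<close> from above
  by \<open>\<integral> \<parallel>F\<parallel> d\<mu>\<close>; the lower bound comes from pairing with a measurable norming functional.
\<close>

section \<open>The projective seminorm and its completion\<close>

text \<open>Evaluates the concatenation of two representations of lengths \<open>n\<close> and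
  \<open>m\<close>.\<close>

lemma sum_lessThan_append:
  fixes f :: "nat \<Rightarrow> real"
  shows "(\<Sum>i<n+m. if i < n then f i else g (i - n)) = (\<Sum>i<n. f i) + (\<Sum>i<m. g i)"
  by (induction m) simp_all

text \<open>These hypotheses carry the seminorm calculus: costs are nonnegative, and the negation of
  a tensor is carried out in its left factor at unchanged cost.\<close>

locale tensor_pair =
  fixes X :: "'x normed_vs" and Y :: "'y normed_vs"
  assumes norm_nonneg_X: "x \<in> vcarrier X \<Longrightarrow> 0 \<le> vnorm X x"
    and norm_nonneg_Y: "y \<in> vcarrier Y \<Longrightarrow> 0 \<le> vnorm Y y"
    and uminus_closed_X: "x \<in> vcarrier X \<Longrightarrow> vscale X (- 1) x \<in> vcarrier X"
    and norm_uminus_X: "x \<in> vcarrier X \<Longrightarrow> vnorm X (vscale X (- 1) x) = vnorm X x"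
begin

abbreviation V :: "('x, 'y) tensor normed_vs" where "V \<equiv> alg_tensor X Y"
abbreviation Vc :: "('x, 'y) tensor set" where "Vc \<equiv> vcarrier V"
abbreviation pnorm :: "('x, 'y) tensor \<Rightarrow> real" where "pnorm \<equiv> vnorm V"

lemma vzero_V: "vzero V = (\<lambda>B. 0)"
  and vadd_V: "vadd V u v = (\<lambda>B. u B + v B)"
  and vscale_V: "vscale V c u = (\<lambda>B. c * u B)"
  and vdist_V: "vdist V u v = pnorm (\<lambda>B. u B - v B)"
  by (simp_all add: alg_tensor_def vdist_def)

lemma mem_Vc: "u \<in> Vc \<longleftrightarrow> (\<exists>n x y. finite_rep X Y n x y u)"
  by (simp add: alg_tensor_def)

lemma pnorm_eq:
  "pnorm u = Inf {\<Sum>i<n. vnorm X (x i) * vnorm Y (y i) | n x y. finite_rep X Y n x y u}"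
  by (simp add: alg_tensor_def)

section \<open>Representations under addition and negation\<close>

lemma finite_rep_zero: "finite_rep X Y 0 x y (\<lambda>B. 0)"
  by (simp add: finite_rep_def)

lemma finite_rep_elem:
  "x \<in> vcarrier X \<Longrightarrow> y \<in> vcarrier Y \<Longrightarrow>
    finite_rep X Y 1 (\<lambda>i. x) (\<lambda>i. y) (elem_tensor X Y x y)"
  by (simp add: finite_rep_def)

lemma finite_rep_add:
  assumes "finite_rep X Y n x y u" "finite_rep X Y m x' y' v"
  shows "finite_rep X Y (n + m) (\<lambda>i. if i < n then x i else x' (i - n))
    (\<lambda>i. if i < n then y i else y' (i - n)) (\<lambda>B. u B + v B)"
proof -
  have "(\<Sum>i<n+m. elem_tensor X Y (if i < n then x i else x' (i - n))
      (if i < n then y i else y' (i - n)) B) = u B + v B" for B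
  proof -
    have "(\<Sum>i<n+m. elem_tensor X Y (if i < n then x i else x' (i - n))
      (if i < n then y i else y' (i - n)) B) =
      (\<Sum>i<n+m. if i < n then elem_tensor X Y (x i) (y i) B else elem_tensor X Y (x' (i - n)) (y' (i - n)) B)"
      by (intro sum.cong) auto
    also have "\<dots> = u B + v B"
      using assms by (subst sum_lessThan_append) (simp add: finite_rep_def)
    finally show ?thesis .
  qed
  then show ?thesis using assms by (auto simp: finite_rep_def)
qed

lemma finite_rep_uminus:
  assumes "finite_rep X Y n x y u"
  shows "finite_rep X Y n (\<lambda>i. vscale X (- 1) (x i)) y (\<lambda>B. - u B)"
proof -
  have "elem_tensor X Y (vscale X (- 1) a) b B = - elem_tensor X Y a b B"
    if "a \<in> vcarrier X" "b \<in> vcarrier Y" for a b B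
    using that by (simp add: elem_tensor_def bilinear_form_def)
  then show ?thesis using assms
    by (auto simp: finite_rep_def uminus_closed_X sum_negf)
qed

lemma zero_Vc: "(\<lambda>B. 0) \<in> Vc"
  using finite_rep_zero mem_Vc by blast

lemma elem_Vc: "x \<in> vcarrier X \<Longrightarrow> y \<in> vcarrier Y \<Longrightarrow> elem_tensor X Y x y \<in> Vc"
  using finite_rep_elem mem_Vc by blast

lemma add_Vc: "u \<in> Vc \<Longrightarrow> v \<in> Vc \<Longrightarrow> (\<lambda>B. u B + v B) \<in> Vc"
  using finite_rep_add unfolding mem_Vc by blast

lemma uminus_Vc: "u \<in> Vc \<Longrightarrow> (\<lambda>B. - u B) \<in> Vc"
  using finite_rep_uminus unfolding mem_Vc by blast

lemma diff_Vc: "u \<in> Vc \<Longrightarrow> v \<in> Vc \<Longrightarrow> (\<lambda>B. u B - v B) \<in> Vc"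
  using add_Vc[OF _ uminus_Vc, of u v] by simp

section \<open>The projective seminorm as an infimum of costs\<close>

lemma rep_sum_nonneg:
  assumes "finite_rep X Y n x y u"
  shows "0 \<le> (\<Sum>i<n. vnorm X (x i) * vnorm Y (y i))"
  using assms by (intro sum_nonneg mult_nonneg_nonneg norm_nonneg_X norm_nonneg_Y)
    (auto simp: finite_rep_def)

lemma pnorm_le:
  assumes "finite_rep X Y n x y u"
  shows "pnorm u \<le> (\<Sum>i<n. vnorm X (x i) * vnorm Y (y i))"
  unfolding pnorm_eq
proof (rule cInf_lower)
  show "bdd_below {\<Sum>i<n. vnorm X (x i) * vnorm Y (y i) | n x y. finite_rep X Y n x y u}"
    using rep_sum_nonneg by (intro bdd_belowI[of _ 0]) blast
qed (use assms in blast)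

text \<open>Membership of \<open>u\<close> provides a representation, so the infimum runs over a
  nonempty set and inherits every lower bound of the costs.\<close>

lemma pnorm_ge:
  assumes "u \<in> Vc"
    and "\<And>n x y. finite_rep X Y n x y u \<Longrightarrow> c \<le> (\<Sum>i<n. vnorm X (x i) * vnorm Y (y i))"
  shows "c \<le> pnorm u"
  unfolding pnorm_eq by (rule cInf_greatest) (use assms in \<open>auto simp: mem_Vc\<close>)

lemma pnorm_nonneg: "u \<in> Vc \<Longrightarrow> 0 \<le> pnorm u"
  by (rule pnorm_ge) (auto intro: rep_sum_nonneg)

lemma pnorm_zero: "pnorm (\<lambda>B. 0) = 0"
  using pnorm_le[OF finite_rep_zero] pnorm_nonneg[OF zero_Vc] by simp

text \<open>Concatenation adds costs. The infima over the two families of representations are then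
  taken one after the other, the remaining term being moved across the inequality.\<close>

lemma pnorm_add_le:
  assumes "u \<in> Vc" "v \<in> Vc"
  shows "pnorm (\<lambda>B. u B + v B) \<le> pnorm u + pnorm v"
proof -
  have *: "pnorm (\<lambda>B. u B + v B) \<le>
      (\<Sum>i<n. vnorm X (x i) * vnorm Y (y i)) + (\<Sum>i<m. vnorm X (x' i) * vnorm Y (y' i))"
    if "finite_rep X Y n x y u" "finite_rep X Y m x' y' v" for n x y m x' y'
  proof -
    have "(\<Sum>i<n+m. vnorm X (if i < n then x i else x' (i - n)) * vnorm Y (if i < n then y i else y' (i - n)))
        = (\<Sum>i<n+m. if i < n then vnorm X (x i) * vnorm Y (y i)
              else vnorm X (x' (i - n)) * vnorm Y (y' (i - n)))"
      by (intro sum.cong) auto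
    also have "\<dots> = (\<Sum>i<n. vnorm X (x i) * vnorm Y (y i)) + (\<Sum>i<m. vnorm X (x' i) * vnorm Y (y' i))"
      by (rule sum_lessThan_append)
    finally show ?thesis using pnorm_le[OF finite_rep_add[OF that]] by simp
  qed
  have "pnorm (\<lambda>B. u B + v B) - (\<Sum>i<n. vnorm X (x i) * vnorm Y (y i)) \<le> pnorm v"
    if "finite_rep X Y n x y u" for n x y
    using *[OF that] by (intro pnorm_ge assms) (simp add: algebra_simps)
  then have "pnorm (\<lambda>B. u B + v B) - pnorm v \<le> pnorm u"
    by (intro pnorm_ge assms) (simp add: algebra_simps)
  then show ?thesis by simp
qed

lemma pnorm_uminus_le:
  assumes "u \<in> Vc"
  shows "pnorm (\<lambda>B. - u B) \<le> pnorm u"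
proof (rule pnorm_ge[OF assms])
  fix n x y assume rep: "finite_rep X Y n x y u"
  have "(\<Sum>i<n. vnorm X (vscale X (- 1) (x i)) * vnorm Y (y i)) = (\<Sum>i<n. vnorm X (x i) * vnorm Y (y i))"
    using rep by (intro sum.cong) (auto simp: finite_rep_def norm_uminus_X)
  then show "pnorm (\<lambda>B. - u B) \<le> (\<Sum>i<n. vnorm X (x i) * vnorm Y (y i))"
    using pnorm_le[OF finite_rep_uminus[OF rep]] by simp
qed

lemma pnorm_uminus: "u \<in> Vc \<Longrightarrow> pnorm (\<lambda>B. - u B) = pnorm u"
  using pnorm_uminus_le[of u] pnorm_uminus_le[OF uminus_Vc, of u] by simp

lemma pnorm_minus_commute:
  "u \<in> Vc \<Longrightarrow> v \<in> Vc \<Longrightarrow> pnorm (\<lambda>B. u B - v B) = pnorm (\<lambda>B. v B - u B)"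
  using pnorm_uminus[OF diff_Vc, of u v] by simp

lemma pnorm_triangle:
  "u \<in> Vc \<Longrightarrow> v \<in> Vc \<Longrightarrow> w \<in> Vc \<Longrightarrow>
    pnorm (\<lambda>B. u B - w B) \<le> pnorm (\<lambda>B. u B - v B) + pnorm (\<lambda>B. v B - w B)"
  using pnorm_add_le[OF diff_Vc diff_Vc, of u v v w] by simp

lemma abs_pnorm_diff_le:
  assumes "u \<in> Vc" "v \<in> Vc"
  shows "\<bar>pnorm u - pnorm v\<bar> \<le> pnorm (\<lambda>B. u B - v B)"
  using pnorm_add_le[OF diff_Vc, of u v v] pnorm_add_le[OF diff_Vc, of v u u]
    pnorm_minus_commute[of u v] assms by simp

section \<open>Cauchy sequences of tensors modulo null sequences\<close>

abbreviation cauchy :: "(nat \<Rightarrow> ('x, 'y) tensor) \<Rightarrow> bool" where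
  "cauchy s \<equiv> s \<in> cauchy_seqs V"

text \<open>The relation inside \<open>cauchy_class\<close>, with the difference written pointwise
  so that the seminorm lemmas apply directly.\<close>

definition equiv_seq :: "(nat \<Rightarrow> ('x, 'y) tensor) \<Rightarrow> (nat \<Rightarrow> ('x, 'y) tensor) \<Rightarrow> bool" where
  "equiv_seq s t \<longleftrightarrow> (\<lambda>n. pnorm (\<lambda>B. s n B - t n B)) \<longlonglongrightarrow> 0"

lemma cauchyD_Vc: "cauchy s \<Longrightarrow> s n \<in> Vc"
  by (simp add: cauchy_seqs_def)

lemma cauchyD:
  "cauchy s \<Longrightarrow> 0 < \<epsilon> \<Longrightarrow> \<exists>N. \<forall>m\<ge>N. \<forall>n\<ge>N. pnorm (\<lambda>B. s m B - s n B) < \<epsilon>"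
  by (simp add: cauchy_seqs_def vdist_V)

lemma cauchyI:
  assumes "\<And>n. s n \<in> Vc"
    and "\<And>\<epsilon>. 0 < \<epsilon> \<Longrightarrow> \<exists>N. \<forall>m\<ge>N. \<forall>n\<ge>N. pnorm (\<lambda>B. s m B - s n B) < \<epsilon>"
  shows "cauchy s"
  using assms by (simp add: cauchy_seqs_def vdist_V)

lemma mem_cauchy_class: "t \<in> cauchy_class V s \<longleftrightarrow> cauchy t \<and> equiv_seq s t"
  by (simp add: cauchy_class_def equiv_seq_def vdist_V)

lemma equiv_seq_refl: "equiv_seq s s"
  by (simp add: equiv_seq_def pnorm_zero)

lemma equiv_seqI:
  assumes "\<And>n. s n \<in> Vc" "\<And>n. t n \<in> Vc" "\<And>n. pnorm (\<lambda>B. s n B - t n B) \<le> f n" "f \<longlonglongrightarrow> 0"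
  shows "equiv_seq s t"
  unfolding equiv_seq_def
  by (rule tendsto_sandwich[OF _ _ tendsto_const assms(4)])
    (auto intro!: always_eventually pnorm_nonneg diff_Vc assms)

lemma equiv_seq_sym:
  "(\<And>n. s n \<in> Vc) \<Longrightarrow> (\<And>n. t n \<in> Vc) \<Longrightarrow> equiv_seq s t \<Longrightarrow> equiv_seq t s"
  unfolding equiv_seq_def by (subst pnorm_minus_commute) auto

lemma equiv_seq_trans:
  assumes "\<And>n. s n \<in> Vc" "\<And>n. t n \<in> Vc" "\<And>n. r n \<in> Vc" "equiv_seq s t" "equiv_seq t r"
  shows "equiv_seq s r"
  by (rule equiv_seqI[OF assms(1,3) pnorm_triangle[OF assms(1,2,3)]])
    (use tendsto_add[OF assms(4,5)[unfolded equiv_seq_def]] in simp)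

lemma equiv_seq_add:
  assumes "\<And>n. s n \<in> Vc" "\<And>n. t n \<in> Vc" "\<And>n. s' n \<in> Vc" "\<And>n. t' n \<in> Vc"
    "equiv_seq s s'" "equiv_seq t t'"
  shows "equiv_seq (\<lambda>n B. s n B + t n B) (\<lambda>n B. s' n B + t' n B)"
proof (rule equiv_seqI)
  show "pnorm (\<lambda>B. (s n B + t n B) - (s' n B + t' n B)) \<le>
      pnorm (\<lambda>B. s n B - s' n B) + pnorm (\<lambda>B. t n B - t' n B)" for n
    using pnorm_add_le[OF diff_Vc diff_Vc, of "s n" "s' n" "t n" "t' n"] assms
    by (simp add: algebra_simps)
  show "(\<lambda>n. pnorm (\<lambda>B. s n B - s' n B) + pnorm (\<lambda>B. t n B - t' n B)) \<longlonglongrightarrow> 0"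
    using tendsto_add[OF assms(5,6)[unfolded equiv_seq_def]] by simp
qed (use assms in \<open>auto intro: add_Vc\<close>)

lemma equiv_seq_uminus:
  assumes "\<And>n. s n \<in> Vc" "\<And>n. t n \<in> Vc" "equiv_seq s t"
  shows "equiv_seq (\<lambda>n B. - s n B) (\<lambda>n B. - t n B)"
  using equiv_seq_sym[OF assms] by (simp add: equiv_seq_def)

text \<open>The seminorm is 1-Lipschitz, so its limit does not depend on the representative.\<close>

lemma equiv_seq_tendsto_pnorm:
  assumes "\<And>n. s n \<in> Vc" "\<And>n. t n \<in> Vc" "equiv_seq s t" "(\<lambda>n. pnorm (s n)) \<longlonglongrightarrow> L"
  shows "(\<lambda>n. pnorm (t n)) \<longlonglongrightarrow> L"
proof -
  have "(\<lambda>n. pnorm (s n) - pnorm (t n)) \<longlonglongrightarrow> 0"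
    by (rule Lim_null_comparison[OF _ assms(3)[unfolded equiv_seq_def]])
      (auto intro!: always_eventually abs_pnorm_diff_le assms)
  from tendsto_diff[OF assms(4) this] show ?thesis by simp
qed

text \<open>A three-epsilon argument: the Cauchy condition for \<open>s\<close> in the middle,
  closeness to \<open>t\<close> at both ends. It permits passing to a more convenient representative
  of a class.\<close>

lemma cauchy_equiv:
  assumes "cauchy s" "\<And>n. t n \<in> Vc" "equiv_seq s t"
  shows "cauchy t"
proof (rule cauchyI)
  fix \<epsilon> :: real assume "0 < \<epsilon>"
  then have e: "\<epsilon> / 3 > 0" by simp
  obtain N1 where N1: "\<And>m n. m \<ge> N1 \<Longrightarrow> n \<ge> N1 \<Longrightarrow> pnorm (\<lambda>B. s m B - s n B) < \<epsilon> / 3"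
    using cauchyD[OF assms(1) e] by blast
  obtain N2 where N2: "\<And>n. n \<ge> N2 \<Longrightarrow> \<bar>pnorm (\<lambda>B. s n B - t n B)\<bar> < \<epsilon> / 3"
    using LIMSEQ_D[OF assms(3)[unfolded equiv_seq_def] e] by auto
  note sV = cauchyD_Vc[OF assms(1)]
  have "pnorm (\<lambda>B. t m B - t n B) < \<epsilon>" if "m \<ge> max N1 N2" "n \<ge> max N1 N2" for m n
    using pnorm_triangle[of "t m" "s m" "t n"] pnorm_triangle[of "s m" "s n" "t n"] assms(2) sV
      pnorm_minus_commute[OF assms(2) sV, of m m] N1[of m n] N2[of m] N2[of n] that by simp
  then show "\<exists>N. \<forall>m\<ge>N. \<forall>n\<ge>N. pnorm (\<lambda>B. t m B - t n B) < \<epsilon>" by blast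
qed (rule assms)

lemma cauchy_uminus:
  assumes "cauchy s"
  shows "cauchy (\<lambda>n B. - s n B)"
proof (rule cauchyI)
  fix \<epsilon> :: real assume "0 < \<epsilon>"
  then obtain N where "\<forall>m\<ge>N. \<forall>n\<ge>N. pnorm (\<lambda>B. s m B - s n B) < \<epsilon>"
    using cauchyD[OF assms] by blast
  moreover have "pnorm (\<lambda>B. - s m B - - s n B) = pnorm (\<lambda>B. s m B - s n B)" for m n
    using pnorm_minus_commute[OF cauchyD_Vc cauchyD_Vc, OF assms assms, of n m] by simp
  ultimately show "\<exists>N. \<forall>m\<ge>N. \<forall>n\<ge>N. pnorm (\<lambda>B. - s m B - - s n B) < \<epsilon>" by auto
qed (use assms in \<open>auto intro: uminus_Vc cauchyD_Vc\<close>)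

lemma cauchy_add:
  assumes "cauchy s" "cauchy t"
  shows "cauchy (\<lambda>n B. s n B + t n B)"
proof (rule cauchyI)
  fix \<epsilon> :: real assume "0 < \<epsilon>"
  then have e: "\<epsilon> / 2 > 0" by simp
  obtain N1 where N1: "\<And>m n. m \<ge> N1 \<Longrightarrow> n \<ge> N1 \<Longrightarrow> pnorm (\<lambda>B. s m B - s n B) < \<epsilon> / 2"
    using cauchyD[OF assms(1) e] by blast
  obtain N2 where N2: "\<And>m n. m \<ge> N2 \<Longrightarrow> n \<ge> N2 \<Longrightarrow> pnorm (\<lambda>B. t m B - t n B) < \<epsilon> / 2"
    using cauchyD[OF assms(2) e] by blast
  have "pnorm (\<lambda>B. s m B + t m B - (s n B + t n B)) < \<epsilon>"
    if "m \<ge> max N1 N2" "n \<ge> max N1 N2" for m n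
  proof -
    have "pnorm (\<lambda>B. s m B - s n B + (t m B - t n B)) < \<epsilon>"
      using pnorm_add_le[OF diff_Vc diff_Vc, of "s m" "s n" "t m" "t n"] assms[THEN cauchyD_Vc]
        N1[of m n] N2[of m n] that by fastforce
    then show ?thesis by (simp add: algebra_simps)
  qed
  then show "\<exists>N. \<forall>m\<ge>N. \<forall>n\<ge>N. pnorm (\<lambda>B. s m B + t m B - (s n B + t n B)) < \<epsilon>" by blast
qed (use assms in \<open>auto intro: add_Vc cauchyD_Vc\<close>)

lemma cauchy_const: "u \<in> Vc \<Longrightarrow> cauchy (\<lambda>n. u)"
  by (rule cauchyI) (auto simp: pnorm_zero)

text \<open>The class contains \<open>s\<close>, so the choice in \<open>cauchy_rep\<close> returns
  a member of it.\<close>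

lemma cauchy_rep_class:
  assumes "cauchy s"
  shows "cauchy (cauchy_rep (cauchy_class V s))" "equiv_seq s (cauchy_rep (cauchy_class V s))"
proof -
  have "s \<in> cauchy_class V s" using assms equiv_seq_refl by (simp add: mem_cauchy_class)
  then have "cauchy_rep (cauchy_class V s) \<in> cauchy_class V s"
    unfolding cauchy_rep_def by (rule someI[of "\<lambda>r. r \<in> cauchy_class V s"])
  then show "cauchy (cauchy_rep (cauchy_class V s))" "equiv_seq s (cauchy_rep (cauchy_class V s))"
    by (simp_all add: mem_cauchy_class)
qed

lemma cauchy_class_eqI:
  assumes "cauchy s" "cauchy t" "equiv_seq s t"
  shows "cauchy_class V s = cauchy_class V t"
proof -
  have "equiv_seq s r \<longleftrightarrow> equiv_seq t r" if "cauchy r" for r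
    using equiv_seq_trans[of s t r] equiv_seq_trans[of t s r] equiv_seq_sym[of s t] assms that
    by (auto dest: cauchyD_Vc)
  then show ?thesis by (auto simp: mem_cauchy_class)
qed

section \<open>Operations of the completion on classes\<close>

abbreviation P :: "('x, 'y) proj_tensor normed_vs" where "P \<equiv> proj_tensor_product X Y"

lemma P_eqs:
  "vcarrier P = cauchy_class V ` cauchy_seqs V"
  "vzero P = cauchy_class V (\<lambda>n. vzero V)"
  "vadd P S T = cauchy_class V (\<lambda>n. vadd V (cauchy_rep S n) (cauchy_rep T n))"
  "vscale P c S = cauchy_class V (\<lambda>n. vscale V c (cauchy_rep S n))"
  "vnorm P S = lim (\<lambda>n. vnorm V (cauchy_rep S n))"
  by (simp_all add: proj_tensor_product_def completion_def)

text \<open>Independence of representatives: addition in the completion uses the chosen ones, and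
  these are equivalent to \<open>s\<close> and \<open>t\<close>.\<close>

lemma vadd_P_class:
  assumes "cauchy s" "cauchy t"
  shows "vadd P (cauchy_class V s) (cauchy_class V t) = cauchy_class V (\<lambda>n B. s n B + t n B)"
  unfolding P_eqs vadd_V
  by (rule cauchy_class_eqI[symmetric])
    (use assms in \<open>auto intro!: cauchy_add equiv_seq_add cauchy_rep_class dest: cauchyD_Vc
       intro: cauchyD_Vc cauchy_rep_class\<close>)

lemma vscale_P_class:
  assumes "cauchy s"
  shows "vscale P (- 1) (cauchy_class V s) = cauchy_class V (\<lambda>n B. - s n B)"
  unfolding P_eqs vscale_V mult_minus1
  by (rule cauchy_class_eqI[symmetric])
    (use assms in \<open>auto intro!: cauchy_uminus equiv_seq_uminus cauchy_rep_class dest: cauchyD_Vc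
       intro: cauchyD_Vc cauchy_rep_class\<close>)

lemma vnorm_P_class:
  assumes "cauchy s" "(\<lambda>n. pnorm (s n)) \<longlonglongrightarrow> L"
  shows "vnorm P (cauchy_class V s) = L"
  unfolding P_eqs
  by (intro limI equiv_seq_tendsto_pnorm[OF _ _ cauchy_rep_class(2) assms(2)]
      cauchyD_Vc cauchy_rep_class assms(1))

lemma vdist_P_class:
  assumes "cauchy s" "cauchy t" "(\<lambda>n. pnorm (\<lambda>B. s n B - t n B)) \<longlonglongrightarrow> L"
  shows "vdist P (cauchy_class V s) (cauchy_class V t) = L"
proof -
  have "vdist P (cauchy_class V s) (cauchy_class V t) =
      vnorm P (cauchy_class V (\<lambda>n B. s n B + - t n B))"
    unfolding vdist_def using assms by (simp only: vscale_P_class vadd_P_class cauchy_uminus)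
  also have "\<dots> = L"
    using assms by (intro vnorm_P_class cauchy_add cauchy_uminus) auto
  finally show ?thesis .
qed

lemma sum_elem_Vc:
  assumes "\<And>i. x i \<in> vcarrier X" "\<And>i. y i \<in> vcarrier Y"
  shows "(\<lambda>B. \<Sum>i<m::nat. elem_tensor X Y (x i) (y i) B) \<in> Vc"
proof -
  have "finite_rep X Y m x y (\<lambda>B. \<Sum>i<m. elem_tensor X Y (x i) (y i) B)"
    using assms by (simp add: finite_rep_def)
  then show ?thesis unfolding mem_Vc by blast
qed

lemma vsum_P_elem:
  assumes "\<And>i. x i \<in> vcarrier X" "\<And>i. y i \<in> vcarrier Y"
  shows "vsum P (\<lambda>i. proj_elem_tensor X Y (x i) (y i)) m =
    cauchy_class V (\<lambda>n B. \<Sum>i<m. elem_tensor X Y (x i) (y i) B)"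
proof (induction m)
  case 0
  then show ?case by (simp add: P_eqs vzero_V)
next
  case (Suc m)
  show ?case
    unfolding vsum.simps(2) Suc unfolding proj_elem_tensor_def
    by (subst vadd_P_class) (auto intro!: cauchy_const sum_elem_Vc elem_Vc assms)
qed

end

section \<open>Layer cake decomposition in \<open>c\<^sub>0\<close>\<close>

text \<open>The supremum norm as an extended nonnegative number, so that it is meaningful for
  unbounded functions too and can be fed to the nonnegative integral.\<close>

definition sup_nn :: "('g \<Rightarrow> real) \<Rightarrow> ennreal" where
  "sup_nn x = (SUP k. ennreal \<bar>x k\<bar>)"

lemma le_sup_nn: "ennreal \<bar>x k\<bar> \<le> sup_nn x"
  unfolding sup_nn_def by (rule SUP_upper) simp

lemma sup_nn_le_iff: "sup_nn x \<le> c \<longleftrightarrow> (\<forall>k. ennreal \<bar>x k\<bar> \<le> c)"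
  by (auto simp: sup_nn_def SUP_le_iff)

definition level :: "('g \<Rightarrow> real) \<Rightarrow> real \<Rightarrow> 'g \<Rightarrow> real" where
  "level x s k = of_bool (s < x k) - of_bool (x k < - s)"

text \<open>The pair \<open>(P, Q)\<close> lists the places of 1 and -1, a common place giving 0.
  Indexing by pairs of finite sets makes countability immediate.\<close>

definition sign_vectors :: "'g set \<Rightarrow> ('g \<Rightarrow> real) set" where
  "sign_vectors K = (\<lambda>(P, Q) k. of_bool (k \<in> P) - of_bool (k \<in> Q)) `
     ({P. P \<subseteq> K \<and> finite P} \<times> {Q. Q \<subseteq> K \<and> finite Q})"

lemma countable_sign_vectors: "countable K \<Longrightarrow> countable (sign_vectors K)"
  unfolding sign_vectors_def
  by (intro countable_image countable_SIGMA) (simp_all add: countable_Collect_finite_subset conj_commute)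

lemma finite_sign_vectors: "finite K \<Longrightarrow> finite (sign_vectors K)"
  unfolding sign_vectors_def by simp

lemma zero_sign_vectors: "(\<lambda>k. 0) \<in> sign_vectors K"
  unfolding sign_vectors_def by (rule image_eqI[where x = "({}, {})"]) auto

lemma sign_vectorsD:
  assumes "y \<in> sign_vectors K"
  shows "finite {k. y k \<noteq> 0}" "{k. y k \<noteq> 0} \<subseteq> K" "y k \<in> {- 1, 0, 1}"
proof -
  obtain P Q where PQ: "P \<subseteq> K" "finite P" "Q \<subseteq> K" "finite Q"
    and y: "y = (\<lambda>k. of_bool (k \<in> P) - of_bool (k \<in> Q))"
    using assms by (auto simp: sign_vectors_def)
  have sub: "{k. y k \<noteq> 0} \<subseteq> P \<union> Q" by (auto simp: y)
  show "finite {k. y k \<noteq> 0}" using finite_subset[OF sub] PQ by simp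
  show "{k. y k \<noteq> 0} \<subseteq> K" using sub PQ by blast
  show "y k \<in> {- 1, 0, 1}" by (simp add: y)
qed

text \<open>Only coordinates of absolute value above \<open>s\<close> survive: finitely many by the
  \<open>c0\<close> condition, and all in \<open>K\<close> because \<open>x\<close> vanishes
  elsewhere and \<open>s\<close> is positive.\<close>

lemma level_in_sign_vectors:
  assumes "\<And>k. k \<notin> K \<Longrightarrow> x k = 0" "\<And>\<epsilon>. 0 < \<epsilon> \<Longrightarrow> finite {k. \<epsilon> < \<bar>x k\<bar>}" "0 < s"
  shows "level x s \<in> sign_vectors K"
proof -
  have "{k. s < x k} \<subseteq> {k. s < \<bar>x k\<bar>}" "{k. x k < - s} \<subseteq> {k. s < \<bar>x k\<bar>}" by auto
  then have "finite {k. s < x k}" "finite {k. x k < - s}"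
    using assms(2)[OF assms(3)] by (auto intro: finite_subset)
  moreover have "{k. s < x k} \<subseteq> K" "{k. x k < - s} \<subseteq> K"
    using assms(1,3) by force+
  ultimately show ?thesis
    unfolding sign_vectors_def
    by (intro image_eqI[where x = "({k. s < x k}, {k. x k < - s})"]) (auto simp: level_def)
qed

text \<open>
  Only the first index enumerating a vector gets a non-empty level set, since \<open>y\<close> need not be
  injective, and the zero vector gets none, since its level set would have infinite measure.
\<close>

definition level_set :: "(nat \<Rightarrow> 'g \<Rightarrow> real) \<Rightarrow> ('g \<Rightarrow> real) \<Rightarrow> nat \<Rightarrow> real set" where
  "level_set y x i = {s. 0 < s \<and> level x s = y i \<and> y i \<noteq> (\<lambda>k. 0) \<and> (\<forall>j<i. y j \<noteq> y i)}"

lemma disjoint_level_set: "disjoint_family (level_set y x)"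
  unfolding disjoint_family_on_def level_set_def
  by auto (metis linorder_neqE_nat)

lemma UN_level_set:
  assumes "\<And>s. 0 < s \<Longrightarrow> level x s \<in> range y"
  shows "(\<Union>i. level_set y x i) = {s. 0 < s \<and> level x s \<noteq> (\<lambda>k. 0)}"
proof (intro equalityI subsetI)
  fix s assume s: "s \<in> {s. 0 < s \<and> level x s \<noteq> (\<lambda>k. 0)}"
  then obtain i where "level x s = y i" using assms by auto
  \<comment> \<open>The least index with this value satisfies the first-occurrence condition in
    \<open>level_set\<close>.\<close>
  then have "level x s = y (LEAST i. level x s = y i)" by (rule LeastI)
  moreover have "y j \<noteq> level x s" if "j < (LEAST i. level x s = y i)" for j
    using not_less_Least[OF that] by simp
  ultimately have "s \<in> level_set y x (LEAST i. level x s = y i)"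
    using s by (simp add: level_set_def)
  then show "s \<in> (\<Union>i. level_set y x i)" by blast
qed (auto simp: level_set_def)

lemma level_nonzero_iff:
  assumes "0 < s"
  shows "level x s k \<noteq> 0 \<longleftrightarrow> s < \<bar>x k\<bar>"
  using assms by (auto simp: level_def)

text \<open>A positive \<open>s\<close> has a nonzero level vector exactly when it lies below some
  \<open>\<bar>x k\<bar>\<close>. Such \<open>s\<close> fill the interval from 0 to the supremum up
  to its end point, also when the supremum is infinite or not attained.\<close>

lemma emeasure_level_sets:
  fixes x :: "'g \<Rightarrow> real"
  assumes "\<And>s. 0 < s \<Longrightarrow> level x s \<in> range y"
    and "\<And>i. level_set y x i \<in> sets lborel"
  shows "(\<Sum>i. emeasure lborel (level_set y x i)) = sup_nn x"
proof -
  let ?U = "{s. 0 < s \<and> level x s \<noteq> (\<lambda>k. 0)}"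
  have U: "?U = {s. 0 < s \<and> (\<exists>k. s < \<bar>x k\<bar>)}"
    using level_nonzero_iff[of _ x] by (auto simp: fun_eq_iff)
  have sets: "?U \<in> sets lborel"
    using sets.countable_UN[of "level_set y x" UNIV lborel] UN_level_set[of x y, OF assms(1)] assms(2) by auto
  have "(\<Sum>i. emeasure lborel (level_set y x i)) = emeasure lborel ?U"
    using assms disjoint_level_set by (subst suminf_emeasure) (auto simp: UN_level_set)
  also have "\<dots> = sup_nn x"
  proof (rule antisym)
    show "emeasure lborel ?U \<le> sup_nn x"
    proof (cases "sup_nn x")
      case (real r)
      have "?U \<subseteq> {0..r}"
      proof
        fix s assume "s \<in> ?U"
        then obtain k where k: "0 < s" "s < \<bar>x k\<bar>" unfolding U by blast
        have "\<bar>x k\<bar> \<le> r" using le_sup_nn[of x k] real by simp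
        then show "s \<in> {0..r}" using k by simp
      qed
      then have "emeasure lborel ?U \<le> emeasure lborel {0..r}" by (rule emeasure_mono) simp
      also have "\<dots> = sup_nn x" using real by simp
      finally show ?thesis .
    qed simp
    show "sup_nn x \<le> emeasure lborel ?U"
      unfolding sup_nn_le_iff
    proof
      fix k
      have "ennreal \<bar>x k\<bar> = emeasure lborel {0<..<\<bar>x k\<bar>}" by simp
      also have "\<dots> \<le> emeasure lborel ?U"
        by (rule emeasure_mono[OF _ sets]) (auto simp: U)
      finally show "ennreal \<bar>x k\<bar> \<le> emeasure lborel ?U" .
    qed
  qed
  finally show ?thesis .
qed

text \<open>A nonempty level set belongs to a vector with a nonzero entry at some \<open>k\<close>,
  and agreement of \<open>level x s\<close> with this vector forces
  \<open>s < \<bar>x k\<bar>\<close>.\<close>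

lemma emeasure_level_set_finite:
  assumes "level_set y x i \<in> sets lborel"
  shows "emeasure lborel (level_set y x i) < \<infinity>"
proof (cases "level_set y x i = {}")
  case False
  then obtain k where k: "y i k \<noteq> 0" by (auto simp: level_set_def)
  have "level_set y x i \<subseteq> {0..\<bar>x k\<bar>}"
  proof
    fix s assume "s \<in> level_set y x i"
    then have "0 < s" "level x s k \<noteq> 0" using k by (auto simp: level_set_def)
    then show "s \<in> {0..\<bar>x k\<bar>}" using level_nonzero_iff[of s x k] by simp
  qed
  then have "emeasure lborel (level_set y x i) \<le> emeasure lborel {0..\<bar>x k\<bar>}"
    by (rule emeasure_mono) simp
  then show ?thesis by (auto simp: top_unique order_le_less_trans)
qed simp

text \<open>Fix \<open>k\<close>. The level sets whose vector has a nonzero entry at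
  \<open>k\<close> partition the interval from 0 to \<open>\<bar>x k\<bar>\<close>, and wherever
  they are nonempty that entry is the sign of \<open>x k\<close>. Adding lengths gives
  \<open>\<bar>x k\<bar> * sgn (x k)\<close>.\<close>

lemma level_sets_sums:
  fixes x :: "'g \<Rightarrow> real"
  assumes "\<And>s. 0 < s \<Longrightarrow> level x s \<in> range y"
    and "\<And>i. level_set y x i \<in> sets lborel"
  shows "(\<lambda>i. measure lborel (level_set y x i) * y i k) sums x k"
proof -
  define A where "A i = (if y i k \<noteq> 0 then level_set y x i else {})" for i
  have setsA: "A i \<in> sets lborel" for i using assms(2) by (simp add: A_def)
  have "disjoint_family A"
    using disjoint_level_set[of y x] by (auto simp: disjoint_family_on_def A_def)
  have UA: "(\<Union>i. A i) = {0<..<\<bar>x k\<bar>}"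
  proof (intro equalityI subsetI)
    fix s assume "s \<in> (\<Union>i. A i)"
    then have "0 < s" "level x s k \<noteq> 0" by (auto simp: A_def level_set_def split: if_splits)
    then show "s \<in> {0<..<\<bar>x k\<bar>}" using level_nonzero_iff[of s x k] by simp
  next
    fix s assume s: "s \<in> {0<..<\<bar>x k\<bar>}"
    then have *: "level x s k \<noteq> 0" using level_nonzero_iff[of s x k] by simp
    then have "level x s \<noteq> (\<lambda>k. 0)" by auto
    then have "s \<in> (\<Union>i. level_set y x i)" using s UN_level_set[of x y, OF assms(1)] by auto
    then obtain i where i: "s \<in> level_set y x i" by blast
    then have "y i k \<noteq> 0" using * by (simp add: level_set_def)
    then show "s \<in> (\<Union>i. A i)" using i by (auto simp: A_def)
  qed
  have "(\<lambda>i. measure lborel (A i)) sums measure lborel (\<Union>i. A i)"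
    using UA \<open>disjoint_family A\<close> setsA by (intro measure_UNION) auto
  then have "(\<lambda>i. measure lborel (A i)) sums \<bar>x k\<bar>" by (simp add: UA)
  then have "(\<lambda>i. measure lborel (A i) * sgn (x k)) sums (\<bar>x k\<bar> * sgn (x k))"
    by (rule sums_mult2)
  moreover have "measure lborel (A i) * sgn (x k) = measure lborel (level_set y x i) * y i k" for i
  proof (cases "A i = {}")
    case True
    then show ?thesis by (auto simp: A_def split: if_splits)
  next
    case False
    then obtain s where "s \<in> level_set y x i" "y i k \<noteq> 0" by (auto simp: A_def split: if_splits)
    then have "0 < s" "y i k = level x s k" "level x s k \<noteq> 0" by (auto simp: level_set_def)
    then have "y i k = sgn (x k)" by (auto simp: level_def sgn_if split: if_splits)
    then show ?thesis using \<open>y i k \<noteq> 0\<close> by (simp add: A_def)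
  qed
  ultimately show ?thesis by (simp add: abs_mult_sgn mult.commute)
qed

text \<open>Equality of vectors is an intersection over possibly uncountably many coordinates.
  Outside \<open>K\<close> both vectors vanish for positive \<open>s\<close>, so the countable set
  \<open>K\<close> decides it and the condition is measurable jointly in \<open>t\<close> and
  \<open>s\<close>.\<close>

lemma level_set_graph_measurable:
  fixes F :: "'a \<Rightarrow> 'g \<Rightarrow> real"
  assumes "countable K" "\<And>k. (\<lambda>t. F t k) \<in> borel_measurable M"
    and "\<And>t k. k \<notin> K \<Longrightarrow> F t k = 0" "\<And>k. k \<notin> K \<Longrightarrow> y i k = 0"
  shows "{p \<in> space (M \<Otimes>\<^sub>M lborel). snd p \<in> level_set y (F (fst p)) i} \<in> sets (M \<Otimes>\<^sub>M lborel)"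
proof -
  have [measurable]: "\<And>k. (\<lambda>t. F t k) \<in> borel_measurable M" by fact
  have "level (F t) s = y i \<longleftrightarrow> (\<forall>k\<in>K. level (F t) s k = y i k)" if "0 < s" for t s
  proof -
    have "level (F t) s k = y i k" if "k \<notin> K" for k
      using assms(3)[OF that, of t] assms(4)[OF that] \<open>0 < s\<close> by (simp add: level_def)
    then show ?thesis unfolding fun_eq_iff by blast
  qed
  then have *: "snd p \<in> level_set y (F (fst p)) i \<longleftrightarrow>
      0 < snd p \<and> (\<forall>k\<in>K. level (F (fst p)) (snd p) k = y i k) \<and>
      y i \<noteq> (\<lambda>k. 0) \<and> (\<forall>j<i. y j \<noteq> y i)" for p
    by (auto simp: level_set_def)
  show ?thesis
    unfolding * level_def
    by (intro sets.sets_Collect_conj sets.sets_Collect_countable_All'[OF _ assms(1)] sets.sets_Collect_const)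
      measurable
qed

text \<open>One enumeration of vectors serves all \<open>t\<close>. The last conclusion turns the
  series into a finite sum over a finite \<open>K\<close>, which yields representations in the
  algebraic tensor product.\<close>

theorem layer_cake_decomposition:
  fixes F :: "'a \<Rightarrow> 'g \<Rightarrow> real"
  assumes "countable K" and meas: "\<And>k. (\<lambda>t. F t k) \<in> borel_measurable M"
    and supp: "\<And>t k. k \<notin> K \<Longrightarrow> F t k = 0"
    and c0: "\<And>t \<epsilon>. 0 < \<epsilon> \<Longrightarrow> finite {k. \<epsilon> < \<bar>F t k\<bar>}"
  obtains g :: "nat \<Rightarrow> 'a \<Rightarrow> real" and y :: "nat \<Rightarrow> 'g \<Rightarrow> real" where
    "\<And>i. g i \<in> borel_measurable M" "\<And>i t. 0 \<le> g i t" "\<And>i. y i \<in> sign_vectors K"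
    "\<And>i t. y i = (\<lambda>k. 0) \<Longrightarrow> g i t = 0"
    "\<And>t k. t \<in> space M \<Longrightarrow> (\<lambda>i. g i t * y i k) sums F t k"
    "\<And>t. t \<in> space M \<Longrightarrow> (\<Sum>i. ennreal (g i t)) = sup_nn (F t)"
    "finite K \<Longrightarrow> \<exists>n. \<forall>i\<ge>n. \<forall>t. g i t = 0"
proof
  \<comment> \<open>The enumeration repeats values when \<open>sign_vectors K\<close> is finite; the
    first-occurrence condition of \<open>level_set\<close> absorbs this.\<close>
  define y where "y = from_nat_into (sign_vectors K)"
  have ne: "sign_vectors K \<noteq> {}" using zero_sign_vectors by blast
  have rangey: "range y = sign_vectors K"
    unfolding y_def using ne countable_sign_vectors[OF assms(1)] by (rule range_from_nat_into)
  show y: "y i \<in> sign_vectors K" for i using rangey by blast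
  have lev: "level (F t) s \<in> range y" if "0 < s" for t s
    unfolding rangey using supp c0 that by (intro level_in_sign_vectors) auto
  \<comment> \<open>The graph of the level sets over \<open>t\<close>. Its sections are the sets
    \<open>level_set y (F t) i\<close>, so their lengths depend measurably on
    \<open>t\<close>.\<close>
  define E where "E i = {p \<in> space (M \<Otimes>\<^sub>M lborel). snd p \<in> level_set y (F (fst p)) i}" for i
  have E: "E i \<in> sets (M \<Otimes>\<^sub>M lborel)" for i
    unfolding E_def
    by (rule level_set_graph_measurable[OF assms(1-3)]) (use sign_vectorsD(2)[OF y] in auto)
  have slice: "Pair t -` E i = level_set y (F t) i" if "t \<in> space M" for t i
    using that by (auto simp: E_def space_pair_measure)
  have sets: "level_set y (F t) i \<in> sets lborel" if "t \<in> space M" for t i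
    using sets_Pair1[OF E, of t i] slice[OF that] by simp
  define g where "g i t = measure lborel (level_set y (F t) i)" for i t
  show "g i \<in> borel_measurable M" for i
  proof -
    have "(\<lambda>t. enn2real (emeasure lborel (Pair t -` E i))) \<in> borel_measurable M"
      using lborel.measurable_emeasure_Pair[OF E] by measurable
    then show ?thesis
      by (rule measurable_cong[THEN iffD1, rotated]) (simp add: slice g_def measure_def)
  qed
  show "0 \<le> g i t" for i t by (simp add: g_def)
  show "g i t = 0" if "y i = (\<lambda>k. 0)" for i t using that by (simp add: g_def level_set_def)
  show "(\<lambda>i. g i t * y i k) sums F t k" if "t \<in> space M" for t k
    unfolding g_def using lev sets[OF that] by (rule level_sets_sums)
  show "(\<Sum>i. ennreal (g i t)) = sup_nn (F t)" if "t \<in> space M" for t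
  proof -
    have "ennreal (g i t) = emeasure lborel (level_set y (F t) i)" for i
      unfolding g_def using emeasure_level_set_finite[OF sets[OF that], of i]
      by (subst emeasure_eq_ennreal_measure) auto
    then show ?thesis using emeasure_level_sets[OF lev sets[OF that]] by simp
  qed
  show "\<exists>n. \<forall>i\<ge>n. \<forall>t. g i t = 0" if "finite K"
  proof -
    \<comment> \<open>First occurrences: \<open>y\<close> is injective on them with values in a
      finite set, and every other index has an empty level set.\<close>
    let ?I = "{i. \<forall>j<i. y j \<noteq> y i}"
    have "inj_on y ?I"
      by (rule inj_onI) (metis (mono_tags, lifting) linorder_neqE_nat mem_Collect_eq)
    moreover have "finite (y ` ?I)"
      by (rule finite_subset[OF _ finite_sign_vectors[OF that]]) (use rangey in auto)
    ultimately have "finite ?I" by (rule finite_imageD[rotated])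
    then obtain n where n: "?I \<subseteq> {..<n}" using finite_nat_iff_bounded by auto
    have "g i t = 0" if "n \<le> i" for i t
    proof -
      have "i \<notin> ?I" using n that by auto
      then have "level_set y (F t) i = {}" by (auto simp: level_set_def)
      then show ?thesis by (simp add: g_def)
    qed
    then show ?thesis by blast
  qed
qed

section \<open>Tensors with finitely many coordinates\<close>

lemma L1_class_eqI: "(AE t in M. f t = g t) \<Longrightarrow> L1_class M f = L1_class M g"
  unfolding L1_class_def by (auto elim: AE_mp)

lemma L1_rep_class:
  assumes "integrable M f"
  shows "integrable M (L1_rep (L1_class M f))" "AE t in M. L1_rep (L1_class M f) t = f t"
proof -
  have "f \<in> L1_class M f" using assms by (simp add: L1_class_def)
  then have "L1_rep (L1_class M f) \<in> L1_class M f"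
    unfolding L1_rep_def by (rule someI[of "\<lambda>g. g \<in> L1_class M f"])
  then show "integrable M (L1_rep (L1_class M f))" "AE t in M. L1_rep (L1_class M f) t = f t"
    by (auto simp: L1_class_def)
qed

lemma L1_class_carrier: "integrable M f \<Longrightarrow> L1_class M f \<in> vcarrier (L1 M)"
  by (simp add: L1_def)

lemma L1_carrierE:
  assumes "a \<in> vcarrier (L1 M)"
  obtains f where "integrable M f" "a = L1_class M f"
  using assms by (auto simp: L1_def)

lemma L1_norm_class:
  assumes "integrable M f"
  shows "vnorm (L1 M) (L1_class M f) = (\<integral>t. \<bar>f t\<bar> \<partial>M)"
  unfolding L1_def using L1_rep_class[OF assms] assms by (auto intro!: integral_cong_AE)

lemma L1_add_class:
  assumes "integrable M f" "integrable M g"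
  shows "vadd (L1 M) (L1_class M f) (L1_class M g) = L1_class M (\<lambda>t. f t + g t)"
  unfolding L1_def using L1_rep_class[OF assms(1)] L1_rep_class[OF assms(2)]
  by (auto intro!: L1_class_eqI)

lemma L1_scale_class:
  assumes "integrable M f"
  shows "vscale (L1 M) c (L1_class M f) = L1_class M (\<lambda>t. c * f t)"
  unfolding L1_def using L1_rep_class[OF assms] by (auto intro!: L1_class_eqI)

section \<open>Elements and norm of \<open>c0\<close>\<close>

lemma c0_carrier:
  "x \<in> vcarrier (c0 \<Gamma>) \<longleftrightarrow> (\<forall>k. k \<notin> \<Gamma> \<longrightarrow> x k = 0) \<and> (\<forall>\<epsilon>>0. finite {k. \<epsilon> < \<bar>x k\<bar>})"
proof -
  have "{k \<in> \<Gamma>. \<epsilon> < \<bar>x k\<bar>} = {k. \<epsilon> < \<bar>x k\<bar>}" if "\<forall>k. k \<notin> \<Gamma> \<longrightarrow> x k = 0" "\<epsilon> > 0" for \<epsilon>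
    using that by force
  then show ?thesis by (auto simp: c0_def)
qed

lemma c0_ops: "vadd (c0 \<Gamma>) x y = (\<lambda>k. x k + y k)" "vscale (c0 \<Gamma>) c x = (\<lambda>k. c * x k)"
  "vnorm (c0 \<Gamma>) x = (SUP k. \<bar>x k\<bar>)"
  by (simp_all add: c0_def)

lemma finite_support_c0:
  assumes "finite K" "K \<subseteq> \<Gamma>" "\<And>k. k \<notin> K \<Longrightarrow> x k = 0"
  shows "x \<in> vcarrier (c0 \<Gamma>)"
proof -
  have "{k. \<epsilon> < \<bar>x k\<bar>} \<subseteq> K" if "0 < \<epsilon>" for \<epsilon> using assms(3) that by force
  then show ?thesis using assms by (auto simp: c0_carrier intro: finite_subset)
qed

lemma c0_bdd_above:
  assumes "x \<in> vcarrier (c0 \<Gamma>)"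
  shows "bdd_above (range (\<lambda>k. \<bar>x k\<bar>))"
proof -
  have fin: "finite {k. 1 < \<bar>x k\<bar>}" using assms by (simp add: c0_carrier)
  \<comment> \<open>All but finitely many entries are at most 1 in absolute value.\<close>
  have "range (\<lambda>k. \<bar>x k\<bar>) \<subseteq> (\<lambda>k. \<bar>x k\<bar>) ` {k. 1 < \<bar>x k\<bar>} \<union> {..1}" by force
  then show ?thesis
    using fin by (meson bdd_above_Un bdd_above_finite bdd_above_mono bdd_above_Iic finite_imageI)
qed

lemma c0_norm_ge: "x \<in> vcarrier (c0 \<Gamma>) \<Longrightarrow> \<bar>x k\<bar> \<le> vnorm (c0 \<Gamma>) x"
  unfolding c0_ops by (rule cSUP_upper[OF _ c0_bdd_above]) auto

lemma c0_norm_nonneg: "x \<in> vcarrier (c0 \<Gamma>) \<Longrightarrow> 0 \<le> vnorm (c0 \<Gamma>) x"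
  using c0_norm_ge[of x \<Gamma>] by (meson abs_ge_zero order_trans)

lemma c0_norm_le: "(\<And>k. \<bar>x k\<bar> \<le> c) \<Longrightarrow> vnorm (c0 \<Gamma>) x \<le> c"
  unfolding c0_ops by (rule cSUP_least) auto

lemma sign_vector_c0:
  assumes "y \<in> sign_vectors K" "K \<subseteq> \<Gamma>"
  shows "y \<in> vcarrier (c0 \<Gamma>)"
  by (rule finite_support_c0[of "{k. y k \<noteq> 0}"]) (use sign_vectorsD[OF assms(1)] assms(2) in auto)

lemma sign_vector_norm:
  assumes "y \<in> sign_vectors K" "K \<subseteq> \<Gamma>" "y \<noteq> (\<lambda>k. 0)"
  shows "vnorm (c0 \<Gamma>) y = 1"
proof (rule antisym)
  have abs: "\<bar>y k\<bar> = (if y k = 0 then 0 else 1)" for k using sign_vectorsD(3)[OF assms(1), of k] by auto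
  then show "vnorm (c0 \<Gamma>) y \<le> 1" by (intro c0_norm_le) simp
  obtain k where "y k \<noteq> 0" using assms(3) by auto
  then show "1 \<le> vnorm (c0 \<Gamma>) y"
    using c0_norm_ge[OF sign_vector_c0[OF assms(1,2)], of k] abs[of k] by simp
qed

interpretation L1_c0: tensor_pair "L1 M" "c0 \<Gamma>" for M :: "'a measure" and \<Gamma> :: "'g set"
proof
  show "0 \<le> vnorm (L1 M) x" if "x \<in> vcarrier (L1 M)" for x
    by (simp add: L1_def)
  show "0 \<le> vnorm (c0 \<Gamma>) y" if "y \<in> vcarrier (c0 \<Gamma>)" for y
    using that by (rule c0_norm_nonneg)
  show "vscale (L1 M) (- 1) x \<in> vcarrier (L1 M)" "vnorm (L1 M) (vscale (L1 M) (- 1) x) = vnorm (L1 M) x"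
    if x: "x \<in> vcarrier (L1 M)" for x
  proof -
    obtain f where f: "integrable M f" "x = L1_class M f" using L1_carrierE[OF x] .
    then show "vscale (L1 M) (- 1) x \<in> vcarrier (L1 M)"
      by (simp add: L1_scale_class L1_class_carrier)
    show "vnorm (L1 M) (vscale (L1 M) (- 1) x) = vnorm (L1 M) x"
      using f by (simp add: L1_scale_class L1_norm_class)
  qed
qed

section \<open>Bilinear forms on finite sums\<close>

lemma bilinear_class_sum:
  assumes B: "bilinear_form (L1 M) (c0 \<Gamma>) B" and x: "x \<in> vcarrier (c0 \<Gamma>)"
    and "finite I" "\<And>i. i \<in> I \<Longrightarrow> integrable M (f i)"
  shows "B (L1_class M (\<lambda>t. \<Sum>i\<in>I. f i t)) x = (\<Sum>i\<in>I. B (L1_class M (f i)) x)"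
  using assms(3,4)
proof (induction I rule: finite_induct)
  case empty
  \<comment> \<open>The empty sum is the zero class, which is 0 times itself, so homogeneity makes
    \<open>B\<close> vanish there.\<close>
  have "B (vscale (L1 M) 0 (L1_class M (\<lambda>t. 0))) x = 0 * B (L1_class M (\<lambda>t. 0)) x"
    using B x L1_class_carrier[of M "\<lambda>t. 0"] unfolding bilinear_form_def by blast
  then show ?case by (simp add: L1_scale_class)
next
  case (insert i I)
  have int: "integrable M (f i)" "integrable M (\<lambda>t. \<Sum>i\<in>I. f i t)" using insert by auto
  have "B (vadd (L1 M) (L1_class M (f i)) (L1_class M (\<lambda>t. \<Sum>i\<in>I. f i t))) x =
      B (L1_class M (f i)) x + B (L1_class M (\<lambda>t. \<Sum>i\<in>I. f i t)) x"
    using B x L1_class_carrier[OF int(1)] L1_class_carrier[OF int(2)] unfolding bilinear_form_def by blast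
  then show ?case using insert int by (simp add: L1_add_class)
qed

lemma bilinear_class_scale:
  assumes "bilinear_form (L1 M) (c0 \<Gamma>) B" "x \<in> vcarrier (c0 \<Gamma>)" "integrable M f"
  shows "B (L1_class M (\<lambda>t. c * f t)) x = c * B (L1_class M f) x"
  using assms L1_class_carrier[OF assms(3)]
  unfolding bilinear_form_def L1_scale_class[OF assms(3), symmetric] by blast

abbreviation unit_vec :: "'g \<Rightarrow> 'g \<Rightarrow> real" where
  "unit_vec k \<equiv> (\<lambda>j. of_bool (j = k))"

lemma unit_vec_c0: "k \<in> \<Gamma> \<Longrightarrow> unit_vec k \<in> vcarrier (c0 \<Gamma>)"
  by (rule finite_support_c0[of "{k}"]) auto

text \<open>A vector supported on the finite set \<open>K\<close> is a finite combination of unit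
  vectors, so algebra alone determines \<open>B a x\<close>. This is why finite supports are used:
  \<open>B\<close> may be unbounded.\<close>

lemma bilinear_finite_support:
  assumes B: "bilinear_form (L1 M) (c0 \<Gamma>) B" and a: "a \<in> vcarrier (L1 M)"
    and K: "finite K" "K \<subseteq> \<Gamma>" and x: "\<And>k. k \<notin> K \<Longrightarrow> x k = 0"
  shows "B a x = (\<Sum>k\<in>K. x k * B a (unit_vec k))"
proof -
  note scale = B[unfolded bilinear_form_def, THEN conjunct2, THEN conjunct2, THEN conjunct2,
      rule_format, OF a, unfolded c0_ops]
  note add = B[unfolded bilinear_form_def, THEN conjunct2, THEN conjunct1, rule_format, OF a, unfolded c0_ops]
  have "B a (\<lambda>j. \<Sum>k\<in>K. x k * unit_vec k j) = (\<Sum>k\<in>K. x k * B a (unit_vec k))"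
    using K
  proof (induction K rule: finite_induct)
    case empty
    show ?case using scale[of "\<lambda>j. 0" 0] by (simp add: c0_carrier)
  next
    case (insert i K)
    have 1: "unit_vec i \<in> vcarrier (c0 \<Gamma>)" using insert by (intro unit_vec_c0) auto
    have 2: "(\<lambda>j. x i * unit_vec i j) \<in> vcarrier (c0 \<Gamma>)"
      using insert by (intro finite_support_c0[of "{i}"]) auto
    have 3: "(\<lambda>j. \<Sum>k\<in>K. x k * unit_vec k j) \<in> vcarrier (c0 \<Gamma>)"
      using insert by (intro finite_support_c0[of K]) (auto intro!: sum.neutral)
    show ?case
      using insert.IH insert.prems add[OF 2 3] scale[OF 1, of "x i"]
      by (simp only: sum.insert[OF insert.hyps] insert_subset)
  qed
  moreover have "(\<lambda>j. \<Sum>k\<in>K. x k * unit_vec k j) = x"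
  proof
    fix j
    show "(\<Sum>k\<in>K. x k * unit_vec k j) = x j"
    proof (cases "j \<in> K")
      case True
      have "(\<Sum>k\<in>K. x k * unit_vec k j) = (\<Sum>k\<in>K. if k = j then x k else 0)"
        by (intro sum.cong) auto
      then show ?thesis using True K by simp
    next
      case False
      then show ?thesis using x[OF False] by (auto intro!: sum.neutral)
    qed
  qed
  ultimately show ?thesis by simp
qed

text \<open>The algebraic tensor that represents the vector-valued function \<open>F\<close> when
  \<open>F\<close> is supported on the finite set \<open>K\<close>.\<close>

definition coord_tensor ::
  "'a measure \<Rightarrow> 'g set \<Rightarrow> 'g set \<Rightarrow> ('a \<Rightarrow> 'g \<Rightarrow> real) \<Rightarrow> (('a \<Rightarrow> real) set, 'g \<Rightarrow> real) tensor" where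
  "coord_tensor M \<Gamma> K F =
     (\<lambda>B. \<Sum>k\<in>K. elem_tensor (L1 M) (c0 \<Gamma>) (L1_class M (\<lambda>t. F t k)) (unit_vec k) B)"

text \<open>Vanishing off \<open>K\<close> is asked at every \<open>t\<close>, so that suprema of
  such functions run over countable sets of coordinates and stay measurable.\<close>

definition finitely_supported :: "'a measure \<Rightarrow> 'g set \<Rightarrow> ('a \<Rightarrow> 'g \<Rightarrow> real) \<Rightarrow> bool" where
  "finitely_supported M K F \<longleftrightarrow>
     finite K \<and> (\<forall>t k. k \<notin> K \<longrightarrow> F t k = 0) \<and> (\<forall>k. integrable M (\<lambda>t. F t k))"

lemma coord_tensor_not_bilinear:
  "\<not> bilinear_form (L1 M) (c0 \<Gamma>) B \<Longrightarrow> coord_tensor M \<Gamma> K F B = 0"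
  by (simp add: coord_tensor_def elem_tensor_def)

lemma coord_tensor_bilinear:
  "bilinear_form (L1 M) (c0 \<Gamma>) B \<Longrightarrow>
    coord_tensor M \<Gamma> K F B = (\<Sum>k\<in>K. B (L1_class M (\<lambda>t. F t k)) (unit_vec k))"
  by (simp add: coord_tensor_def elem_tensor_def)

text \<open>Expand each \<open>x i\<close> in unit vectors, exchange the two finite sums, and
  collect the coefficients of each unit vector inside \<open>L1\<close>. Arguments that are not
  bilinear forms give 0 on both sides.\<close>

lemma sum_elem_tensor_eq_coord:
  fixes f :: "nat \<Rightarrow> 'a \<Rightarrow> real"
  assumes K: "finite K" "K \<subseteq> \<Gamma>" and x: "\<And>i k. i < n \<Longrightarrow> k \<notin> K \<Longrightarrow> x i k = 0"
    and f: "\<And>i. i < n \<Longrightarrow> integrable M (f i)"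
  shows "(\<lambda>B. \<Sum>i<n. elem_tensor (L1 M) (c0 \<Gamma>) (L1_class M (f i)) (x i) B) =
    coord_tensor M \<Gamma> K (\<lambda>t k. \<Sum>i<n. f i t * x i k)"
proof
  fix B
  show "(\<Sum>i<n. elem_tensor (L1 M) (c0 \<Gamma>) (L1_class M (f i)) (x i) B) =
    coord_tensor M \<Gamma> K (\<lambda>t k. \<Sum>i<n. f i t * x i k) B"
  proof (cases "bilinear_form (L1 M) (c0 \<Gamma>) B")
    case True
    have "(\<Sum>i<n. elem_tensor (L1 M) (c0 \<Gamma>) (L1_class M (f i)) (x i) B) =
        (\<Sum>i<n. \<Sum>k\<in>K. x i k * B (L1_class M (f i)) (unit_vec k))"
    proof (rule sum.cong)
      fix i assume "i \<in> {..<n}"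
      then have i: "i < n" by simp
      show "elem_tensor (L1 M) (c0 \<Gamma>) (L1_class M (f i)) (x i) B =
          (\<Sum>k\<in>K. x i k * B (L1_class M (f i)) (unit_vec k))"
        using bilinear_finite_support[OF True L1_class_carrier[OF f[OF i]] K x[OF i]] True
        by (simp only: elem_tensor_def if_True)
    qed simp
    also have "\<dots> = (\<Sum>k\<in>K. \<Sum>i<n. x i k * B (L1_class M (f i)) (unit_vec k))"
      by (rule sum.swap)
    also have "\<dots> = (\<Sum>k\<in>K. B (L1_class M (\<lambda>t. \<Sum>i<n. x i k * f i t)) (unit_vec k))"
    proof (rule sum.cong)
      fix k assume "k \<in> K"
      then have k: "unit_vec k \<in> vcarrier (c0 \<Gamma>)" using K by (intro unit_vec_c0) auto
      show "(\<Sum>i<n. x i k * B (L1_class M (f i)) (unit_vec k)) =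
          B (L1_class M (\<lambda>t. \<Sum>i<n. x i k * f i t)) (unit_vec k)"
        using f bilinear_class_sum[OF True k, of "{..<n}" "\<lambda>i t. x i k * f i t"]
        by (simp add: bilinear_class_scale[OF True k])
    qed simp
    also have "\<dots> = coord_tensor M \<Gamma> K (\<lambda>t k. \<Sum>i<n. f i t * x i k) B"
      by (simp add: coord_tensor_bilinear[OF True] mult.commute)
    finally show ?thesis .
  qed (simp add: elem_tensor_def coord_tensor_not_bilinear)
qed

text \<open>The added coordinates contribute the zero class. Tensors with different supports can
  thus be compared on the union.\<close>

lemma coord_tensor_mono:
  assumes "finitely_supported M K F" "K \<subseteq> K'" "K' \<subseteq> \<Gamma>" "finite K'"
  shows "coord_tensor M \<Gamma> K F = coord_tensor M \<Gamma> K' F"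
proof
  fix B
  show "coord_tensor M \<Gamma> K F B = coord_tensor M \<Gamma> K' F B"
  proof (cases "bilinear_form (L1 M) (c0 \<Gamma>) B")
    case True
    have "B (L1_class M (\<lambda>t. F t k)) (unit_vec k) = 0" if "k \<in> K' - K" for k
    proof -
      have "(\<lambda>t. F t k) = (\<lambda>t. 0)" using assms that by (auto simp: finitely_supported_def)
      moreover have "unit_vec k \<in> vcarrier (c0 \<Gamma>)" using that assms by (intro unit_vec_c0) auto
      ultimately show ?thesis using bilinear_class_sum[OF True, of _ "{}"] by simp
    qed
    then show ?thesis using assms
      by (auto simp: coord_tensor_bilinear[OF True] intro!: sum.mono_neutral_left)
  qed (simp add: coord_tensor_not_bilinear)
qed

lemma coord_tensor_diff_same:
  assumes "finitely_supported M K F" "finitely_supported M K G" "K \<subseteq> \<Gamma>"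
  shows "(\<lambda>B. coord_tensor M \<Gamma> K F B - coord_tensor M \<Gamma> K G B) = coord_tensor M \<Gamma> K (\<lambda>t k. F t k - G t k)"
proof
  fix B
  show "coord_tensor M \<Gamma> K F B - coord_tensor M \<Gamma> K G B = coord_tensor M \<Gamma> K (\<lambda>t k. F t k - G t k) B"
  proof (cases "bilinear_form (L1 M) (c0 \<Gamma>) B")
    case True
    have "B (L1_class M (\<lambda>t. F t k - G t k)) (unit_vec k) =
        B (L1_class M (\<lambda>t. F t k)) (unit_vec k) - B (L1_class M (\<lambda>t. G t k)) (unit_vec k)"
      if "k \<in> K" for k
    proof -
      have k: "unit_vec k \<in> vcarrier (c0 \<Gamma>)" using that assms by (intro unit_vec_c0) auto
      have int: "integrable M (\<lambda>t. F t k)" "integrable M (\<lambda>t. G t k)"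
        using assms by (auto simp: finitely_supported_def)
      \<comment> \<open>The difference is written as a sum over the two Boolean values so that
        \<open>bilinear_class_sum\<close> covers it.\<close>
      have "integrable M (\<lambda>t. if b then F t k else - 1 * G t k)" for b
        using int by (cases b) auto
      then show ?thesis
        using bilinear_class_sum[OF True k, of UNIV "\<lambda>b t. if b then F t k else - 1 * G t k"] int
          bilinear_class_scale[OF True k int(2), of "- 1"]
        by (simp add: UNIV_bool)
    qed
    then show ?thesis by (simp add: coord_tensor_bilinear[OF True] sum_subtractf)
  qed (simp add: coord_tensor_not_bilinear)
qed

lemma finitely_supported_diff:
  assumes "finitely_supported M K F" "finitely_supported M L G"
  shows "finitely_supported M (K \<union> L) (\<lambda>t k. F t k - G t k)"
  using assms by (auto simp: finitely_supported_def)

lemma finitely_supported_mono: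
  "finitely_supported M K F \<Longrightarrow> K \<subseteq> L \<Longrightarrow> finite L \<Longrightarrow> finitely_supported M L F"
  by (auto simp: finitely_supported_def)

lemma coord_tensor_diff:
  assumes "finitely_supported M K F" "finitely_supported M L G" "K \<subseteq> \<Gamma>" "L \<subseteq> \<Gamma>"
  shows "(\<lambda>B. coord_tensor M \<Gamma> K F B - coord_tensor M \<Gamma> L G B) =
    coord_tensor M \<Gamma> (K \<union> L) (\<lambda>t k. F t k - G t k)"
proof -
  have fin: "finite (K \<union> L)" using assms by (simp add: finitely_supported_def)
  then show ?thesis
    using assms coord_tensor_diff_same[of M "K \<union> L" F G \<Gamma>] coord_tensor_mono[of M K F "K \<union> L" \<Gamma>]
      coord_tensor_mono[of M L G "K \<union> L" \<Gamma>]
    by (simp add: finitely_supported_mono[OF _ _ fin])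
qed

lemma coord_tensor_carrier:
  assumes F: "finitely_supported M K F" and K: "K \<subseteq> \<Gamma>"
  shows "coord_tensor M \<Gamma> K F \<in> vcarrier (alg_tensor (L1 M) (c0 \<Gamma>))"
proof -
  have "finite K" using F by (simp add: finitely_supported_def)
  then obtain e where e: "bij_betw e {..<card K} K"
    using ex_bij_betw_nat_finite atLeast0LessThan by metis
  have "finite_rep (L1 M) (c0 \<Gamma>) (card K) (\<lambda>i. L1_class M (\<lambda>t. F t (e i))) (\<lambda>i. unit_vec (e i))
      (coord_tensor M \<Gamma> K F)"
    unfolding finite_rep_def
  proof
    show "\<forall>i<card K. L1_class M (\<lambda>t. F t (e i)) \<in> vcarrier (L1 M) \<and> unit_vec (e i) \<in> vcarrier (c0 \<Gamma>)"
      using e F K by (auto simp: finitely_supported_def bij_betw_def intro!: L1_class_carrier unit_vec_c0)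
    show "coord_tensor M \<Gamma> K F = (\<lambda>B. \<Sum>i<card K. elem_tensor (L1 M) (c0 \<Gamma>)
        (L1_class M (\<lambda>t. F t (e i))) (unit_vec (e i)) B)"
      unfolding coord_tensor_def by (rule ext, rule sum.reindex_bij_betw[OF e, symmetric])
  qed
  then show ?thesis unfolding L1_c0.mem_Vc by blast
qed

section \<open>The projective norm as an integral\<close>

lemma coord_tensor_cong:
  assumes "\<And>t k. t \<in> space M \<Longrightarrow> F t k = G t k"
  shows "coord_tensor M \<Gamma> K F = coord_tensor M \<Gamma> K G"
proof -
  have "L1_class M (\<lambda>t. F t k) = L1_class M (\<lambda>t. G t k)" for k
    using assms by (intro L1_class_eqI AE_I2)
  then show ?thesis by (simp add: coord_tensor_def)
qed

text \<open>The bilinear form induced by a dual-valued function. Under the bound imposed below, the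
  weights at each point form an element of the unit ball of l1 over \<open>K\<close>.\<close>

definition pairing ::
  "'a measure \<Rightarrow> 'g set \<Rightarrow> ('g \<Rightarrow> 'a \<Rightarrow> real) \<Rightarrow> ('a \<Rightarrow> real) set \<Rightarrow> ('g \<Rightarrow> real) \<Rightarrow> real" where
  "pairing M K \<phi> a x = (\<integral>t. (\<Sum>k\<in>K. \<phi> k t * x k) * L1_rep a t \<partial>M)"

context
  fixes M :: "'a measure" and K :: "'g set" and \<phi> :: "'g \<Rightarrow> 'a \<Rightarrow> real"
  assumes \<phi>_meas: "\<And>k. k \<in> K \<Longrightarrow> \<phi> k \<in> borel_measurable M"
    and \<phi>_sum: "\<And>t. (\<Sum>k\<in>K. \<bar>\<phi> k t\<bar>) \<le> 1"
begin

lemma abs_pairing_weight_le: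
  assumes "\<And>k. k \<in> K \<Longrightarrow> \<bar>x k\<bar> \<le> c" "0 \<le> c"
  shows "\<bar>\<Sum>k\<in>K. \<phi> k t * x k\<bar> \<le> c"
proof -
  have "\<bar>\<Sum>k\<in>K. \<phi> k t * x k\<bar> \<le> (\<Sum>k\<in>K. \<bar>\<phi> k t * x k\<bar>)" by (rule sum_abs)
  also have "\<dots> \<le> (\<Sum>k\<in>K. \<bar>\<phi> k t\<bar> * c)"
    using assms by (intro sum_mono) (auto simp: abs_mult intro!: mult_left_mono)
  also have "\<dots> = (\<Sum>k\<in>K. \<bar>\<phi> k t\<bar>) * c" by (simp add: sum_distrib_right)
  also have "\<dots> \<le> c" using mult_right_mono[OF \<phi>_sum assms(2), of t] by simp
  finally show ?thesis .
qed

lemma pairing_weight_measurable: "(\<lambda>t. \<Sum>k\<in>K. \<phi> k t * x k) \<in> borel_measurable M"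
  using \<phi>_meas by (intro borel_measurable_sum borel_measurable_times) auto

lemma integrable_pairing:
  assumes "finite K" "integrable M f"
  shows "integrable M (\<lambda>t. (\<Sum>k\<in>K. \<phi> k t * x k) * f t)"
proof (rule Bochner_Integration.integrable_bound)
  let ?C = "\<Sum>k\<in>K. \<bar>x k\<bar>"
  show "integrable M (\<lambda>t. ?C * f t)" using assms by simp
  show "(\<lambda>t. (\<Sum>k\<in>K. \<phi> k t * x k) * f t) \<in> borel_measurable M"
    using pairing_weight_measurable assms by measurable
  have "\<bar>x k\<bar> \<le> ?C" if "k \<in> K" for k
    using assms that by (intro member_le_sum) auto
  then have "\<bar>\<Sum>k\<in>K. \<phi> k t * x k\<bar> \<le> ?C" for t
    by (intro abs_pairing_weight_le sum_nonneg) auto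
  then show "AE t in M. norm ((\<Sum>k\<in>K. \<phi> k t * x k) * f t) \<le> norm (?C * f t)"
    by (intro AE_I2) (simp add: abs_mult mult_right_mono)
qed

lemma pairing_class:
  assumes "integrable M f"
  shows "pairing M K \<phi> (L1_class M f) x = (\<integral>t. (\<Sum>k\<in>K. \<phi> k t * x k) * f t \<partial>M)"
  unfolding pairing_def using L1_rep_class[OF assms] assms pairing_weight_measurable[of x]
  by (intro integral_cong_AE) (auto intro!: borel_measurable_times)

lemma bilinear_pairing:
  assumes "finite K"
  shows "bilinear_form (L1 M) (c0 \<Gamma>) (pairing M K \<phi>)"
  unfolding bilinear_form_def
proof (intro conjI allI ballI)
  note int = integrable_pairing[OF assms]
  fix a a' :: "('a \<Rightarrow> real) set" and x x' :: "'g \<Rightarrow> real" and c :: real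
  assume "a \<in> vcarrier (L1 M)"
  then obtain f where f: "integrable M f" "a = L1_class M f" by (rule L1_carrierE)
  show "pairing M K \<phi> a (vadd (c0 \<Gamma>) x x') = pairing M K \<phi> a x + pairing M K \<phi> a x'"
    using f int[OF f(1)]
    by (simp add: pairing_class c0_ops distrib_left distrib_right sum.distrib)
  have eq: "(\<Sum>k\<in>K. \<phi> k t * (c * x k)) * f t = c * ((\<Sum>k\<in>K. \<phi> k t * x k) * f t)" for t
    by (simp add: sum_distrib_left mult_ac)
  show "pairing M K \<phi> a (vscale (c0 \<Gamma>) c x) = c * pairing M K \<phi> a x"
    unfolding f(2) pairing_class[OF f(1)] c0_ops eq by simp
  have eq': "(\<Sum>k\<in>K. \<phi> k t * x k) * (c * f t) = c * ((\<Sum>k\<in>K. \<phi> k t * x k) * f t)" for t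
    by simp
  have cf: "integrable M (\<lambda>t. c * f t)" using f by simp
  show "pairing M K \<phi> (vscale (L1 M) c a) x = c * pairing M K \<phi> a x"
    unfolding f(2) L1_scale_class[OF f(1)] pairing_class[OF f(1)] pairing_class[OF cf] eq' by simp
  assume "a' \<in> vcarrier (L1 M)"
  then obtain g where g: "integrable M g" "a' = L1_class M g" by (rule L1_carrierE)
  show "pairing M K \<phi> (vadd (L1 M) a a') x = pairing M K \<phi> a x + pairing M K \<phi> a' x"
    using f g int[OF f(1)] int[OF g(1)] by (simp add: pairing_class L1_add_class distrib_left)
qed

text \<open>As a bilinear form the pairing has norm at most 1, so its value on a tensor is a lower
  bound for the cost of every representation.\<close>

lemma pairing_le:
  assumes "finite K" "a \<in> vcarrier (L1 M)" "x \<in> vcarrier (c0 \<Gamma>)"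
  shows "pairing M K \<phi> a x \<le> vnorm (L1 M) a * vnorm (c0 \<Gamma>) x"
proof -
  obtain f where f: "integrable M f" "a = L1_class M f" using L1_carrierE[OF assms(2)] .
  have "pairing M K \<phi> a x = (\<integral>t. (\<Sum>k\<in>K. \<phi> k t * x k) * f t \<partial>M)" using f by (simp add: pairing_class)
  also have "\<dots> \<le> (\<integral>t. vnorm (c0 \<Gamma>) x * \<bar>f t\<bar> \<partial>M)"
  proof (rule integral_mono)
    show "integrable M (\<lambda>t. (\<Sum>k\<in>K. \<phi> k t * x k) * f t)" by (rule integrable_pairing[OF assms(1) f(1)])
    show "integrable M (\<lambda>t. vnorm (c0 \<Gamma>) x * \<bar>f t\<bar>)" using f by simp
    fix t
    have "\<bar>\<Sum>k\<in>K. \<phi> k t * x k\<bar> \<le> vnorm (c0 \<Gamma>) x"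
      using c0_norm_ge[OF assms(3)] c0_norm_nonneg[OF assms(3)] by (intro abs_pairing_weight_le)
    then have "\<bar>(\<Sum>k\<in>K. \<phi> k t * x k) * f t\<bar> \<le> vnorm (c0 \<Gamma>) x * \<bar>f t\<bar>"
      unfolding abs_mult by (rule mult_right_mono) simp
    then show "(\<Sum>k\<in>K. \<phi> k t * x k) * f t \<le> vnorm (c0 \<Gamma>) x * \<bar>f t\<bar>" by linarith
  qed
  also have "\<dots> = vnorm (L1 M) a * vnorm (c0 \<Gamma>) x" using f by (simp add: L1_norm_class)
  finally show ?thesis .
qed

end

text \<open>Averaging over all coordinates of maximal modulus avoids a measurable selection of one of them.\<close>

lemma norming_weights:
  fixes F :: "'a \<Rightarrow> 'g \<Rightarrow> real"
  assumes "finitely_supported M K F"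
  obtains \<phi> where "\<And>k. k \<in> K \<Longrightarrow> \<phi> k \<in> borel_measurable M" "\<And>t. (\<Sum>k\<in>K. \<bar>\<phi> k t\<bar>) \<le> 1"
    "\<And>t j. \<bar>F t j\<bar> \<le> (\<Sum>k\<in>K. \<phi> k t * F t k)"
proof
  define top where "top k t = (of_bool (\<forall>j\<in>K. \<bar>F t j\<bar> \<le> \<bar>F t k\<bar>) :: real)" for k t
  define \<phi> where "\<phi> k t = top k t * sgn (F t k) / (\<Sum>j\<in>K. top j t)" for k t
  have K: "finite K" and F: "\<And>k. (\<lambda>t. F t k) \<in> borel_measurable M" and supp: "\<And>t k. k \<notin> K \<Longrightarrow> F t k = 0"
    using assms by (auto simp: finitely_supported_def)
  note [measurable] = F
  have [measurable]: "top k \<in> borel_measurable M" for k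
    unfolding top_def using K by measurable
  show "\<phi> k \<in> borel_measurable M" for k
    unfolding \<phi>_def using K by measurable
  have top_nonneg: "0 \<le> top k t" for k t by (simp add: top_def)
  have S_nonneg: "0 \<le> (\<Sum>j\<in>K. top j t)" for t by (intro sum_nonneg top_nonneg)
  show "(\<Sum>k\<in>K. \<bar>\<phi> k t\<bar>) \<le> 1" for t
  proof -
    have "(\<Sum>k\<in>K. \<bar>\<phi> k t\<bar>) \<le> (\<Sum>k\<in>K. top k t / (\<Sum>j\<in>K. top j t))"
      using S_nonneg top_nonneg
      by (intro sum_mono) (auto simp: \<phi>_def abs_mult abs_sgn_eq intro!: divide_right_mono)
    also have "\<dots> = (\<Sum>k\<in>K. top k t) / (\<Sum>j\<in>K. top j t)" by (rule sum_divide_distrib[symmetric])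
    \<comment> \<open>The quotient is 1, or 0 by the convention for division by zero if
      \<open>K\<close> is empty.\<close>
    also have "\<dots> \<le> 1" by simp
    finally show ?thesis .
  qed
  have \<phi>F: "\<phi> k t * F t k = top k t * \<bar>F t k\<bar> / (\<Sum>j\<in>K. top j t)" for k t
    by (simp add: \<phi>_def mult.assoc sgn_mult_self_eq abs_sgn mult.commute)
  show "\<bar>F t j\<bar> \<le> (\<Sum>k\<in>K. \<phi> k t * F t k)" for t j
  proof (cases "j \<in> K")
    case True
    have "Max ((\<lambda>k. \<bar>F t k\<bar>) ` K) \<in> (\<lambda>k. \<bar>F t k\<bar>) ` K" using K True by (intro Max_in) auto
    then obtain k where k: "k \<in> K" "Max ((\<lambda>k. \<bar>F t k\<bar>) ` K) = \<bar>F t k\<bar>" by auto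
    have "\<bar>F t i\<bar> \<le> \<bar>F t k\<bar>" if "i \<in> K" for i
      unfolding k(2)[symmetric] using K that by (intro Max_ge) auto
    then have "top k t = 1" by (simp add: top_def)
    then have pos: "0 < (\<Sum>j\<in>K. top j t)"
      using K k(1) top_nonneg by (intro sum_pos2[of _ k]) auto
    \<comment> \<open>Where \<open>top k t\<close> is 1 the entry at \<open>k\<close> is maximal and
      dominates \<open>\<bar>F t j\<bar>\<close>; elsewhere both terms vanish.\<close>
    have "\<bar>F t j\<bar> * (\<Sum>k\<in>K. top k t) \<le> (\<Sum>k\<in>K. top k t * \<bar>F t k\<bar>)"
      unfolding sum_distrib_left using True by (intro sum_mono) (auto simp: top_def)
    then show ?thesis
      using pos by (simp add: \<phi>F sum_divide_distrib[symmetric] pos_le_divide_eq)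
  next
    case False
    then show ?thesis
      using S_nonneg top_nonneg by (auto simp: supp \<phi>F intro!: sum_nonneg divide_nonneg_nonneg)
  qed
qed

text \<open>A norming pairing takes a value at least the integral on the tensor, and no
  representation costs less. Conversely, over the finite set \<open>K\<close> the layer cake gives a
  finite representation whose cost is at most the integral of the sum of the \<open>g i\<close>,
  that is of \<open>sup_nn (F t)\<close>.\<close>

theorem pnorm_coord_tensor:
  fixes M :: "'a measure" and \<Gamma> :: "'g set"
  assumes F: "finitely_supported M K F" and K: "K \<subseteq> \<Gamma>"
  shows "ennreal (vnorm (alg_tensor (L1 M) (c0 \<Gamma>)) (coord_tensor M \<Gamma> K F)) = (\<integral>\<^sup>+t. sup_nn (F t) \<partial>M)"
proof (rule antisym)
  let ?p = "vnorm (alg_tensor (L1 M) (c0 \<Gamma>)) (coord_tensor M \<Gamma> K F)"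
  have fin: "finite K" and int: "\<And>k. integrable M (\<lambda>t. F t k)" and supp: "\<And>t k. k \<notin> K \<Longrightarrow> F t k = 0"
    using F by (auto simp: finitely_supported_def)
  obtain \<phi> where \<phi>: "\<And>k. k \<in> K \<Longrightarrow> \<phi> k \<in> borel_measurable M" "\<And>t. (\<Sum>k\<in>K. \<bar>\<phi> k t\<bar>) \<le> 1"
    and norming: "\<And>t j. \<bar>F t j\<bar> \<le> (\<Sum>k\<in>K. \<phi> k t * F t k)"
    using norming_weights[OF F] by blast
  note bil = bilinear_pairing[OF \<phi> fin, where \<Gamma> = \<Gamma>]
  \<comment> \<open>Unit vectors select single weights, so the value of the pairing on the
    coordinate tensor becomes a sum of integrals of \<open>\<phi> k t * F t k\<close>.\<close>
  have pick: "(\<Sum>j\<in>K. \<phi> j t * unit_vec k j) = \<phi> k t" if "k \<in> K" for k t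
  proof -
    have "(\<Sum>j\<in>K. \<phi> j t * unit_vec k j) = (\<Sum>j\<in>K. if j = k then \<phi> j t else 0)"
      by (intro sum.cong) auto
    then show ?thesis using that fin by simp
  qed
  have int_k: "integrable M (\<lambda>t. \<phi> k t * F t k)" if "k \<in> K" for k
    using integrable_pairing[OF \<phi> fin int[of k], where x = "unit_vec k"] by (simp only: pick[OF that])
  have T: "coord_tensor M \<Gamma> K F (pairing M K \<phi>) = (\<integral>t. (\<Sum>k\<in>K. \<phi> k t * F t k) \<partial>M)"
  proof -
    have "coord_tensor M \<Gamma> K F (pairing M K \<phi>) = (\<Sum>k\<in>K. \<integral>t. \<phi> k t * F t k \<partial>M)"
      using coord_tensor_bilinear[OF bil, of K F]
      by (simp add: pairing_class[OF \<phi> int] pick cong: sum.cong)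
    then show ?thesis using int_k by (simp add: Bochner_Integration.integral_sum)
  qed
  have "(\<integral>t. (\<Sum>k\<in>K. \<phi> k t * F t k) \<partial>M) \<le> ?p"
  proof (rule L1_c0.pnorm_ge[OF coord_tensor_carrier[OF F K]])
    fix n a x assume rep: "finite_rep (L1 M) (c0 \<Gamma>) n a x (coord_tensor M \<Gamma> K F)"
    then have "coord_tensor M \<Gamma> K F (pairing M K \<phi>) = (\<Sum>i<n. pairing M K \<phi> (a i) (x i))"
      using bil by (simp add: finite_rep_def elem_tensor_def)
    also have "\<dots> \<le> (\<Sum>i<n. vnorm (L1 M) (a i) * vnorm (c0 \<Gamma>) (x i))"
      using rep by (intro sum_mono pairing_le[OF \<phi> fin]) (auto simp: finite_rep_def)
    finally show "(\<integral>t. (\<Sum>k\<in>K. \<phi> k t * F t k) \<partial>M) \<le> (\<Sum>i<n. vnorm (L1 M) (a i) * vnorm (c0 \<Gamma>) (x i))"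
      unfolding T .
  qed
  moreover have "(\<integral>\<^sup>+t. sup_nn (F t) \<partial>M) \<le> ennreal (\<integral>t. (\<Sum>k\<in>K. \<phi> k t * F t k) \<partial>M)"
  proof -
    have "(\<integral>\<^sup>+t. sup_nn (F t) \<partial>M) \<le> (\<integral>\<^sup>+t. ennreal (\<Sum>k\<in>K. \<phi> k t * F t k) \<partial>M)"
      using norming by (intro nn_integral_mono) (auto simp: sup_nn_le_iff intro!: ennreal_leI)
    also have "\<dots> = ennreal (\<integral>t. (\<Sum>k\<in>K. \<phi> k t * F t k) \<partial>M)"
      using int_k order_trans[OF abs_ge_zero norming]
      by (intro nn_integral_eq_integral Bochner_Integration.integrable_sum) auto
    finally show ?thesis .
  qed
  \<comment> \<open>This direction comes first: it bounds the integral of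
    \<open>sup_nn (F t)\<close> by a finite number, which below makes every \<open>g i\<close>
    integrable.\<close>
  ultimately show le: "(\<integral>\<^sup>+t. sup_nn (F t) \<partial>M) \<le> ennreal ?p"
    by (meson ennreal_leI order_trans)
  have c0: "finite {k. \<epsilon> < \<bar>F t k\<bar>}" if "0 < \<epsilon>" for t \<epsilon>
    by (rule finite_subset[OF _ fin]) (use supp that in force)
  show "ennreal ?p \<le> (\<integral>\<^sup>+t. sup_nn (F t) \<partial>M)"
  proof (rule layer_cake_decomposition[OF countable_finite[OF fin] borel_measurable_integrable[OF int] supp c0])
    fix g y
    assume g: "\<And>i. g i \<in> borel_measurable M" "\<And>i t. 0 \<le> g i t"
      and y: "\<And>i. y i \<in> sign_vectors K"
      and sums: "\<And>t k. t \<in> space M \<Longrightarrow> (\<lambda>i. g i t * y i k) sums F t k"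
      and norm: "\<And>t. t \<in> space M \<Longrightarrow> (\<Sum>i. ennreal (g i t)) = sup_nn (F t)"
      and ev: "finite K \<Longrightarrow> \<exists>n. \<forall>i\<ge>n. \<forall>t. g i t = 0"
    obtain n where n: "\<And>i t. n \<le> i \<Longrightarrow> g i t = 0" using ev fin by blast
    have norm': "(\<Sum>i<n. ennreal (g i t)) = sup_nn (F t)" if "t \<in> space M" for t
      unfolding norm[OF that, symmetric] using n by (subst suminf_finite[of "{..<n}"]) auto
    have F_eq: "F t k = (\<Sum>i<n. g i t * y i k)" if "t \<in> space M" for t k
      using sums_unique2[OF sums[OF that] sums_finite[of "{..<n}" "\<lambda>i. g i t * y i k"]] n by simp
    have nn_sum: "(\<Sum>i<n. \<integral>\<^sup>+t. ennreal (g i t) \<partial>M) = (\<integral>\<^sup>+t. sup_nn (F t) \<partial>M)"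
      using g norm' by (subst nn_integral_sum[symmetric]) (auto intro!: nn_integral_cong)
    have int_g: "integrable M (g i)" if "i < n" for i
    proof (rule integrableI_nonneg)
      have "(\<integral>\<^sup>+t. ennreal (g i t) \<partial>M) \<le> (\<Sum>i<n. \<integral>\<^sup>+t. ennreal (g i t) \<partial>M)"
        using that by (intro member_le_sum) auto
      also have "\<dots> < \<infinity>" unfolding nn_sum using le by (simp add: le_less_trans)
      finally show "(\<integral>\<^sup>+t. ennreal (g i t) \<partial>M) < \<infinity>" .
    qed (use g in auto)
    have "coord_tensor M \<Gamma> K F = coord_tensor M \<Gamma> K (\<lambda>t k. \<Sum>i<n. g i t * y i k)"
      by (rule coord_tensor_cong) (rule F_eq)
    also have "\<dots> = (\<lambda>B. \<Sum>i<n. elem_tensor (L1 M) (c0 \<Gamma>) (L1_class M (g i)) (y i) B)"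
      using sign_vectorsD(2)[OF y] int_g by (intro sum_elem_tensor_eq_coord[OF fin K, symmetric]) auto
    finally have rep: "finite_rep (L1 M) (c0 \<Gamma>) n (\<lambda>i. L1_class M (g i)) y (coord_tensor M \<Gamma> K F)"
      using int_g sign_vector_c0[OF y K] by (simp add: finite_rep_def L1_class_carrier)
    have "?p \<le> (\<Sum>i<n. vnorm (L1 M) (L1_class M (g i)) * vnorm (c0 \<Gamma>) (y i))"
      by (rule L1_c0.pnorm_le[OF rep])
    also have "\<dots> \<le> (\<Sum>i<n. \<integral>t. g i t \<partial>M)"
    proof (rule sum_mono)
      fix i assume "i \<in> {..<n}"
      have "\<bar>y i k\<bar> \<le> 1" for k using sign_vectorsD(3)[OF y, of i k] by auto
      then have "vnorm (c0 \<Gamma>) (y i) \<le> 1" by (rule c0_norm_le)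
      moreover have "vnorm (L1 M) (L1_class M (g i)) = (\<integral>t. g i t \<partial>M)"
        using int_g \<open>i \<in> {..<n}\<close> g by (simp add: L1_norm_class)
      ultimately show "vnorm (L1 M) (L1_class M (g i)) * vnorm (c0 \<Gamma>) (y i) \<le> (\<integral>t. g i t \<partial>M)"
        using g by (simp add: mult_left_le)
    qed
    finally have "ennreal ?p \<le> ennreal (\<Sum>i<n. \<integral>t. g i t \<partial>M)" by (rule ennreal_leI)
    also have "\<dots> = (\<Sum>i<n. \<integral>\<^sup>+t. ennreal (g i t) \<partial>M)"
      using g int_g by (subst sum_ennreal[symmetric]) (auto simp: nn_integral_eq_integral)
    finally show "ennreal ?p \<le> (\<integral>\<^sup>+t. sup_nn (F t) \<partial>M)" unfolding nn_sum .
  qed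
qed

text \<open>Cut every \<open>x i\<close> down to the finite set where some vector of the
  representation exceeds a threshold. The remainders have norm at most the threshold while the left
  factors stay fixed, so the error has small cost.\<close>

lemma approx_coord_tensor:
  assumes u: "u \<in> vcarrier (alg_tensor (L1 M) (c0 \<Gamma>))" and \<epsilon>: "0 < \<epsilon>"
  obtains K F where "finitely_supported M K F" "K \<subseteq> \<Gamma>"
    "vnorm (alg_tensor (L1 M) (c0 \<Gamma>)) (\<lambda>B. u B - coord_tensor M \<Gamma> K F B) < \<epsilon>"
proof -
  obtain n a x where rep: "finite_rep (L1 M) (c0 \<Gamma>) n a x u" using u by (auto simp: L1_c0.mem_Vc)
  have a: "a i \<in> vcarrier (L1 M)" and x: "x i \<in> vcarrier (c0 \<Gamma>)" if "i < n" for i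
    using rep that by (auto simp: finite_rep_def)
  have "\<forall>i<n. \<exists>f. integrable M f \<and> a i = L1_class M f" using a L1_carrierE by metis
  then obtain f where f: "\<And>i. i < n \<Longrightarrow> integrable M (f i)" "\<And>i. i < n \<Longrightarrow> a i = L1_class M (f i)"
    by metis
  define S where "S = (\<Sum>i<n. vnorm (L1 M) (a i))"
  have S: "0 \<le> S" unfolding S_def using a by (intro sum_nonneg L1_c0.norm_nonneg_X) auto
  \<comment> \<open>Chosen so that \<open>S * \<delta> < \<epsilon>\<close>; the summand 1 covers
    the case \<open>S = 0\<close>.\<close>
  define \<delta> where "\<delta> = \<epsilon> / (1 + S)"
  have \<delta>: "0 < \<delta>" using S \<epsilon> by (simp add: \<delta>_def)
  define K where "K = (\<Union>i<n. {k. \<delta> < \<bar>x i k\<bar>})"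
  have K: "finite K" "K \<subseteq> \<Gamma>"
    using x \<delta> unfolding K_def by (force simp: c0_carrier)+
  define x' where "x' i k = (if k \<in> K then x i k else 0)" for i k
  define F where "F t k = (\<Sum>i<n. f i t * x' i k)" for t k
  have F: "finitely_supported M K F"
    unfolding finitely_supported_def F_def using K f by (auto simp: x'_def)
  have coord: "coord_tensor M \<Gamma> K F = (\<lambda>B. \<Sum>i<n. elem_tensor (L1 M) (c0 \<Gamma>) (L1_class M (f i)) (x' i) B)"
    unfolding F_def using f by (intro sum_elem_tensor_eq_coord[OF K, symmetric]) (auto simp: x'_def)
  have x'_c0: "x' i \<in> vcarrier (c0 \<Gamma>)" for i
    using K by (intro finite_support_c0[of K]) (auto simp: x'_def)
  have d_c0: "(\<lambda>k. x i k - x' i k) \<in> vcarrier (c0 \<Gamma>)" if "i < n" for i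
  proof -
    have "{k. e < \<bar>x i k - x' i k\<bar>} \<subseteq> {k. e < \<bar>x i k\<bar>}" if "0 < e" for e
      using that by (auto simp: x'_def)
    then show ?thesis using x[OF that] K by (auto simp: c0_carrier x'_def intro: finite_subset)
  qed
  have "finite_rep (L1 M) (c0 \<Gamma>) n a (\<lambda>i k. x i k - x' i k) (\<lambda>B. u B - coord_tensor M \<Gamma> K F B)"
    unfolding finite_rep_def
  proof (intro conjI allI impI ext)
    fix B
    have "elem_tensor (L1 M) (c0 \<Gamma>) (a i) (\<lambda>k. x i k - x' i k) B =
        elem_tensor (L1 M) (c0 \<Gamma>) (a i) (x i) B - elem_tensor (L1 M) (c0 \<Gamma>) (a i) (x' i) B"
      if i: "i < n" for i
    proof (cases "bilinear_form (L1 M) (c0 \<Gamma>) B")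
      case True
      \<comment> \<open>Additivity is applied to \<open>x i\<close> as remainder plus truncation,
        which gives the formula for the difference.\<close>
      have "B (a i) (\<lambda>k. (x i k - x' i k) + x' i k) = B (a i) (\<lambda>k. x i k - x' i k) + B (a i) (x' i)"
        using True[unfolded bilinear_form_def, THEN conjunct2, THEN conjunct1, rule_format,
            OF a[OF i] d_c0[OF i] x'_c0[of i]] unfolding c0_ops .
      then show ?thesis using True by (simp add: elem_tensor_def)
    qed (simp add: elem_tensor_def)
    then show "u B - coord_tensor M \<Gamma> K F B =
        (\<Sum>i<n. elem_tensor (L1 M) (c0 \<Gamma>) (a i) (\<lambda>k. x i k - x' i k) B)"
      using rep f by (simp add: finite_rep_def coord sum_subtractf)
  qed (use a d_c0 in auto)
  then have "vnorm (alg_tensor (L1 M) (c0 \<Gamma>)) (\<lambda>B. u B - coord_tensor M \<Gamma> K F B) \<le>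
      (\<Sum>i<n. vnorm (L1 M) (a i) * vnorm (c0 \<Gamma>) (\<lambda>k. x i k - x' i k))"
    by (rule L1_c0.pnorm_le)
  also have "\<dots> \<le> (\<Sum>i<n. vnorm (L1 M) (a i) * \<delta>)"
  proof (intro sum_mono mult_left_mono c0_norm_le)
    fix i k assume "i \<in> {..<n}"
    then show "\<bar>x i k - x' i k\<bar> \<le> \<delta>" using \<delta> by (auto simp: x'_def K_def not_less)
  qed (use a L1_c0.norm_nonneg_X in auto)
  also have "\<dots> = S * \<delta>" by (simp add: S_def sum_distrib_right)
  also have "\<dots> < \<epsilon>" using S \<epsilon> by (simp add: \<delta>_def field_simps)
  finally show thesis using that F K by blast
qed

section \<open>Completeness of \<open>L\<^sub>1(\<mu>; c\<^sub>0)\<close>\<close>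

lemma sup_nn_support:
  assumes "\<And>k. k \<notin> K \<Longrightarrow> x k = 0"
  shows "sup_nn x = (SUP k\<in>K. ennreal \<bar>x k\<bar>)"
proof (rule antisym)
  show "sup_nn x \<le> (SUP k\<in>K. ennreal \<bar>x k\<bar>)"
    unfolding sup_nn_le_iff
  proof
    fix k
    show "ennreal \<bar>x k\<bar> \<le> (SUP k\<in>K. ennreal \<bar>x k\<bar>)"
      by (cases "k \<in> K") (auto simp: assms intro: SUP_upper)
  qed
qed (auto intro: SUP_least le_sup_nn)

text \<open>A common countable support reduces the supremum over all indices to a countable
  one.\<close>

lemma sup_nn_measurable:
  assumes "countable K" "\<And>t k. k \<notin> K \<Longrightarrow> F t k = 0" "\<And>k. (\<lambda>t. F t k) \<in> borel_measurable M"
  shows "(\<lambda>t. sup_nn (F t)) \<in> borel_measurable M"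
proof -
  have "sup_nn (F t) = (SUP k\<in>K. ennreal \<bar>F t k\<bar>)" for t using assms(2) by (rule sup_nn_support)
  moreover have "(\<lambda>t. SUP k\<in>K. ennreal \<bar>F t k\<bar>) \<in> borel_measurable M"
    using assms by (intro borel_measurable_SUP) auto
  ultimately show ?thesis by simp
qed

lemma sup_nn_triangle:
  "sup_nn (\<lambda>k. x k - z k) \<le> sup_nn (\<lambda>k. x k - y k) + sup_nn (\<lambda>k. y k - z k)"
  unfolding sup_nn_le_iff
proof
  fix k
  have "ennreal \<bar>x k - z k\<bar> \<le> ennreal (\<bar>x k - y k\<bar> + \<bar>y k - z k\<bar>)" by (intro ennreal_leI) simp
  also have "\<dots> = ennreal \<bar>x k - y k\<bar> + ennreal \<bar>y k - z k\<bar>" by simp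
  also have "\<dots> \<le> sup_nn (\<lambda>k. x k - y k) + sup_nn (\<lambda>k. y k - z k)"
    by (intro add_mono le_sup_nn[of "\<lambda>k. x k - y k"] le_sup_nn[of "\<lambda>k. y k - z k"])
  finally show "ennreal \<bar>x k - z k\<bar> \<le> sup_nn (\<lambda>k. x k - y k) + sup_nn (\<lambda>k. y k - z k)" .
qed

lemma sup_nn_minus_commute: "sup_nn (\<lambda>k. x k - y k) = sup_nn (\<lambda>k. y k - x k)"
  by (simp add: sup_nn_def abs_minus_commute)

text \<open>Each coordinate converges and is dominated by the supremum. Together with Fatou this
  passes integral bounds to pointwise limits.\<close>

lemma sup_nn_lower_semicontinuous:
  assumes "\<And>k. (\<lambda>n. x n k) \<longlonglongrightarrow> z k"
  shows "sup_nn z \<le> liminf (\<lambda>n. sup_nn (x n))"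
  unfolding sup_nn_le_iff
proof
  fix k
  have "(\<lambda>n. ennreal \<bar>x n k\<bar>) \<longlonglongrightarrow> ennreal \<bar>z k\<bar>"
    using assms by (intro tendsto_ennrealI tendsto_rabs)
  then have "ennreal \<bar>z k\<bar> = liminf (\<lambda>n. ennreal \<bar>x n k\<bar>)"
    by (rule lim_imp_Liminf[OF sequentially_bot, symmetric])
  also have "\<dots> \<le> liminf (\<lambda>n. sup_nn (x n))"
    by (intro Liminf_mono always_eventually allI le_sup_nn)
  finally show "ennreal \<bar>z k\<bar> \<le> liminf (\<lambda>n. sup_nn (x n))" .
qed

lemma tendsto_0_ennrealI:
  fixes f :: "nat \<Rightarrow> ennreal"
  assumes "\<And>\<epsilon>. 0 < \<epsilon> \<Longrightarrow> \<exists>N. \<forall>n\<ge>N. f n \<le> ennreal \<epsilon>"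
  shows "f \<longlonglongrightarrow> 0"
proof (rule order_tendstoI)
  fix a :: ennreal assume "0 < a"
  \<comment> \<open>A point strictly between 0 and \<open>a\<close> is finite, so it serves as a
    real threshold even for infinite \<open>a\<close>.\<close>
  then obtain b where b: "0 < b" "b < a" using dense by blast
  then obtain \<epsilon> where \<epsilon>: "0 < \<epsilon>" "ennreal \<epsilon> < a" by (cases b) auto
  obtain N where "\<forall>n\<ge>N. f n \<le> ennreal \<epsilon>" using assms \<epsilon> by blast
  then show "eventually (\<lambda>n. f n < a) sequentially"
    using \<epsilon> unfolding eventually_sequentially by (meson order_le_less_trans)
qed simp

text \<open>The Riesz-Fischer argument for values in \<open>c0\<close>: a fast subsequence converges
  almost everywhere in each coordinate, Fatou gives convergence in the integral norm, and closeness
  to finitely supported vectors puts the limit into \<open>c0\<close>.\<close>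

theorem sup_nn_L1_complete:
  fixes F :: "nat \<Rightarrow> 'a \<Rightarrow> 'g \<Rightarrow> real"
  assumes K: "\<And>n. finite (K n)" and supp: "\<And>n t k. k \<notin> K n \<Longrightarrow> F n t k = 0"
    and meas: "\<And>n k. (\<lambda>t. F n t k) \<in> borel_measurable M"
    and cauchy: "\<And>\<epsilon>. 0 < \<epsilon> \<Longrightarrow> \<exists>N. \<forall>m\<ge>N. \<forall>n\<ge>N.
      (\<integral>\<^sup>+t. sup_nn (\<lambda>k. F m t k - F n t k) \<partial>M) \<le> ennreal \<epsilon>"
  obtains G where "\<And>k. (\<lambda>t. G t k) \<in> borel_measurable M"
    "\<And>t k. k \<notin> (\<Union>n. K n) \<Longrightarrow> G t k = 0"
    "\<And>t \<epsilon>. 0 < \<epsilon> \<Longrightarrow> finite {k. \<epsilon> < \<bar>G t k\<bar>}"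
    "(\<lambda>n. \<integral>\<^sup>+t. sup_nn (\<lambda>k. F n t k - G t k) \<partial>M) \<longlonglongrightarrow> 0"
proof -
  note [measurable] = meas
  have cK: "countable (\<Union>n. K n)" using K by (simp add: countable_finite)
  have diff_meas [measurable]: "(\<lambda>t. sup_nn (\<lambda>k. F m t k - F n t k)) \<in> borel_measurable M" for m n
    by (rule sup_nn_measurable[OF cK]) (auto simp: supp)
  obtain N where N: "\<And>n p q. N n \<le> p \<Longrightarrow> N n \<le> q \<Longrightarrow>
      (\<integral>\<^sup>+t. sup_nn (\<lambda>k. F p t k - F q t k) \<partial>M) \<le> ennreal ((1/2) ^ n)"
  proof -
    have "\<exists>N. \<forall>p\<ge>N. \<forall>q\<ge>N. (\<integral>\<^sup>+t. sup_nn (\<lambda>k. F p t k - F q t k) \<partial>M) \<le> ennreal ((1/2) ^ n)" for n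
      by (rule cauchy) simp
    then have "\<exists>N. \<forall>n. \<forall>p\<ge>N n. \<forall>q\<ge>N n.
        (\<integral>\<^sup>+t. sup_nn (\<lambda>k. F p t k - F q t k) \<partial>M) \<le> ennreal ((1/2) ^ n)"
      by (intro choice allI)
    then show ?thesis using that by blast
  qed
  \<comment> \<open>\<open>r n\<close> is at least \<open>n\<close> and at least each of
    \<open>N 0\<close>, ..., \<open>N n\<close>, so the step from \<open>r n\<close> to
    \<open>r (Suc n)\<close> has integral at most \<open>(1/2) ^ n\<close>.\<close>
  define r where "r n = n + (\<Sum>i\<le>n. N i)" for n
  have rN: "N n \<le> r n" "N n \<le> r (Suc n)" for n
    using member_le_sum[of n "{..n}" N] by (auto simp: r_def)
  \<comment> \<open>The total length of the steps. Where it is finite, all coordinates converge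
    absolutely at once.\<close>
  define h where "h t = (\<Sum>n. sup_nn (\<lambda>k. F (r (Suc n)) t k - F (r n) t k))" for t
  have "(\<integral>\<^sup>+t. h t \<partial>M) = (\<Sum>n. \<integral>\<^sup>+t. sup_nn (\<lambda>k. F (r (Suc n)) t k - F (r n) t k) \<partial>M)"
    unfolding h_def by (rule nn_integral_suminf) (rule diff_meas)
  also have "\<dots> \<le> (\<Sum>n. ennreal ((1/2) ^ n))"
    by (intro suminf_le N rN) auto
  also have "\<dots> < \<infinity>"
    by (subst suminf_ennreal2) (auto intro: summable_geometric)
  finally have "(\<integral>\<^sup>+t. h t \<partial>M) \<noteq> \<infinity>" by simp
  moreover have "h \<in> borel_measurable M" unfolding h_def by measurable
  ultimately have AE_h: "AE t in M. h t \<noteq> \<infinity>" by (rule nn_integral_PInf_AE[rotated])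
  define G0 where "G0 t k = lim (\<lambda>n. F (r n) t k)" for t k
  have conv: "(\<lambda>n. F (r n) t k) \<longlonglongrightarrow> G0 t k" if "h t \<noteq> \<infinity>" for t k
  proof -
    have "(\<Sum>n. ennreal \<bar>F (r (Suc n)) t k - F (r n) t k\<bar>) \<le> h t"
      unfolding h_def by (intro suminf_le le_sup_nn[of "\<lambda>k. F (r (Suc _)) t k - F (r _) t k"]) auto
    then have "summable (\<lambda>n. \<bar>F (r (Suc n)) t k - F (r n) t k\<bar>)"
      using that by (intro summable_suminf_not_top) (auto simp: top_unique)
    then have "summable (\<lambda>n. F (r (Suc n)) t k - F (r n) t k)" by (rule summable_rabs_cancel)
    then have "convergent (\<lambda>n. F (r n) t k - F (r 0) t k)"
      by (simp add: summable_iff_convergent sum_lessThan_telescope[of "\<lambda>n. F (r n) t k"])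
    then have "convergent (\<lambda>n. F (r n) t k)"
      using convergent_diff_const_right_iff[of "\<lambda>n. F (r n) t k"] by simp
    then show ?thesis unfolding G0_def by (simp add: convergent_LIMSEQ_iff)
  qed
  have AE_conv: "AE t in M. \<forall>k. (\<lambda>n. F (r n) t k) \<longlonglongrightarrow> G0 t k"
    by (rule eventually_mono[OF AE_h]) (intro allI conv)
  have G0_meas [measurable]: "(\<lambda>t. G0 t k) \<in> borel_measurable M" for k
    unfolding G0_def by measurable
  have G0_supp: "G0 t k = 0" if "k \<notin> (\<Union>n. K n)" for t k
    using supp that by (auto simp: G0_def)
  have lim_meas [measurable]: "(\<lambda>t. sup_nn (\<lambda>k. F m t k - G0 t k)) \<in> borel_measurable M" for m
    by (rule sup_nn_measurable[OF cK]) (auto simp: supp G0_supp)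
  have lim: "(\<lambda>m. \<integral>\<^sup>+t. sup_nn (\<lambda>k. F m t k - G0 t k) \<partial>M) \<longlonglongrightarrow> 0"
  proof (rule tendsto_0_ennrealI)
    fix \<epsilon> :: real assume "0 < \<epsilon>"
    then obtain N' where N': "\<forall>m\<ge>N'. \<forall>n\<ge>N'. (\<integral>\<^sup>+t. sup_nn (\<lambda>k. F m t k - F n t k) \<partial>M) \<le> ennreal \<epsilon>"
      using cauchy[OF \<open>0 < \<epsilon>\<close>] by blast
    have "(\<integral>\<^sup>+t. sup_nn (\<lambda>k. F m t k - G0 t k) \<partial>M) \<le> ennreal \<epsilon>" if "N' \<le> m" for m
    proof -
      \<comment> \<open>Hold \<open>m\<close> fixed and let the subsequence index tend to infinity:
        lower semicontinuity and Fatou bound the distance to the limit.\<close>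
      have "sup_nn (\<lambda>k. F m t k - G0 t k) \<le> liminf (\<lambda>n. sup_nn (\<lambda>k. F m t k - F (r n) t k))"
        if "\<forall>k. (\<lambda>n. F (r n) t k) \<longlonglongrightarrow> G0 t k" for t
        by (rule sup_nn_lower_semicontinuous) (rule tendsto_diff[OF tendsto_const that[rule_format]])
      then have "AE t in M. sup_nn (\<lambda>k. F m t k - G0 t k) \<le>
          liminf (\<lambda>n. sup_nn (\<lambda>k. F m t k - F (r n) t k))"
        by (rule eventually_mono[OF AE_conv])
      then have "(\<integral>\<^sup>+t. sup_nn (\<lambda>k. F m t k - G0 t k) \<partial>M) \<le>
          (\<integral>\<^sup>+t. liminf (\<lambda>n. sup_nn (\<lambda>k. F m t k - F (r n) t k)) \<partial>M)"
        by (rule nn_integral_mono_AE)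
      also have "\<dots> \<le> liminf (\<lambda>n. \<integral>\<^sup>+t. sup_nn (\<lambda>k. F m t k - F (r n) t k) \<partial>M)"
        by (rule nn_integral_liminf) (rule diff_meas)
      also have "\<dots> \<le> limsup (\<lambda>n. \<integral>\<^sup>+t. sup_nn (\<lambda>k. F m t k - F (r n) t k) \<partial>M)"
        by (rule Liminf_le_Limsup) simp
      also have "\<dots> \<le> ennreal \<epsilon>"
      proof (rule Limsup_bounded)
        have "N' \<le> r n" if "N' \<le> n" for n using that by (simp add: r_def)
        then show "eventually (\<lambda>n. (\<integral>\<^sup>+t. sup_nn (\<lambda>k. F m t k - F (r n) t k) \<partial>M) \<le> ennreal \<epsilon>) sequentially"
          using N' \<open>N' \<le> m\<close> unfolding eventually_sequentially by blast
      qed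
      finally show ?thesis .
    qed
    then show "\<exists>N. \<forall>m\<ge>N. (\<integral>\<^sup>+t. sup_nn (\<lambda>k. F m t k - G0 t k) \<partial>M) \<le> ennreal \<epsilon>" by blast
  qed
  \<comment> \<open>Fatou once more, now in \<open>m\<close>: at almost every \<open>t\<close> some
    \<open>F m t\<close> is as close to \<open>G0 t\<close> as desired in the supremum norm.\<close>
  have "(\<integral>\<^sup>+t. liminf (\<lambda>m. sup_nn (\<lambda>k. F m t k - G0 t k)) \<partial>M) \<le>
      liminf (\<lambda>m. \<integral>\<^sup>+t. sup_nn (\<lambda>k. F m t k - G0 t k) \<partial>M)"
    by (rule nn_integral_liminf) (rule lim_meas)
  also have "\<dots> = 0" using lim by (simp add: lim_imp_Liminf)
  finally have AE_lim0: "AE t in M. liminf (\<lambda>m. sup_nn (\<lambda>k. F m t k - G0 t k)) = 0"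
    by (subst nn_integral_0_iff_AE[symmetric]) auto
  have fin: "finite {k. \<epsilon> < \<bar>G0 t k\<bar>}"
    if lim0: "liminf (\<lambda>m. sup_nn (\<lambda>k. F m t k - G0 t k)) = 0" and "0 < \<epsilon>" for t \<epsilon>
  proof -
    have "\<exists>m. sup_nn (\<lambda>k. F m t k - G0 t k) < ennreal \<epsilon>"
    proof (rule ccontr)
      assume "\<not> ?thesis"
      then have "ennreal \<epsilon> \<le> liminf (\<lambda>m. sup_nn (\<lambda>k. F m t k - G0 t k))"
        by (intro Liminf_bounded always_eventually) (simp add: not_less)
      then show False using lim0 \<open>0 < \<epsilon>\<close> by simp
    qed
    then obtain m where m: "sup_nn (\<lambda>k. F m t k - G0 t k) < ennreal \<epsilon>" by blast
    \<comment> \<open>Off \<open>K m\<close> the difference is \<open>- G0 t k\<close>, so a value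
      above \<open>\<epsilon>\<close> is excluded there.\<close>
    have "{k. \<epsilon> < \<bar>G0 t k\<bar>} \<subseteq> K m"
    proof
      fix k assume k: "k \<in> {k. \<epsilon> < \<bar>G0 t k\<bar>}"
      have "ennreal \<bar>F m t k - G0 t k\<bar> < ennreal \<epsilon>"
        using le_sup_nn[of "\<lambda>k. F m t k - G0 t k" k] m by (rule order_le_less_trans)
      then have "\<bar>F m t k - G0 t k\<bar> < \<epsilon>" by (simp add: ennreal_less_iff)
      then show "k \<in> K m" using supp[of k m t] k by (cases "k \<in> K m") auto
    qed
    then show ?thesis using K finite_subset by blast
  qed
  have "AE t in M. \<forall>\<epsilon>>0. finite {k. \<epsilon> < \<bar>G0 t k\<bar>}"
    by (rule eventually_mono[OF AE_lim0]) (intro allI impI fin)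
  then obtain Z where Z: "{t \<in> space M. \<not> (\<forall>\<epsilon>>0. finite {k. \<epsilon> < \<bar>G0 t k\<bar>})} \<subseteq> Z" "Z \<in> null_sets M"
    by (auto elim!: AE_E intro: null_setsI)
  \<comment> \<open>The layer cake asks for the \<open>c0\<close> condition at every point, so the
    limit is replaced by 0 on a null set containing the exceptional points, and outside the
    space.\<close>
  define G where "G t k = (if t \<in> space M - Z then G0 t k else 0)" for t k
  show thesis
  proof
    have [measurable]: "Z \<in> sets M" using Z by auto
    show "(\<lambda>t. G t k) \<in> borel_measurable M" for k unfolding G_def by measurable
    show "G t k = 0" if "k \<notin> (\<Union>n. K n)" for t k using G0_supp[OF that] by (simp add: G_def)
    show "finite {k. \<epsilon> < \<bar>G t k\<bar>}" if "0 < \<epsilon>" for t \<epsilon>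
      using Z(1) that by (cases "t \<in> space M - Z") (auto simp: G_def)
    have "AE t in M. sup_nn (\<lambda>k. F m t k - G t k) = sup_nn (\<lambda>k. F m t k - G0 t k)" for m
      using AE_not_in[OF Z(2)] AE_space by eventually_elim (simp add: G_def)
    then have "(\<integral>\<^sup>+t. sup_nn (\<lambda>k. F m t k - G t k) \<partial>M) = (\<integral>\<^sup>+t. sup_nn (\<lambda>k. F m t k - G0 t k) \<partial>M)" for m
      by (rule nn_integral_cong_AE)
    then show "(\<lambda>n. \<integral>\<^sup>+t. sup_nn (\<lambda>k. F n t k - G t k) \<partial>M) \<longlonglongrightarrow> 0" using lim by simp
  qed
qed

section \<open>Norm attainment\<close>

text \<open>Two one-sided bounds replace the absolute difference, since subtraction in
  \<open>ennreal\<close> is truncated.\<close>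

lemma tendsto_ennreal_of_close:
  fixes a e :: "nat \<Rightarrow> ennreal"
  assumes "e \<longlonglongrightarrow> 0" "b < \<infinity>" "\<And>n. a n \<le> b + e n" "\<And>n. b \<le> a n + e n"
  shows "a \<longlonglongrightarrow> b"
proof (rule tendsto_sandwich)
  show "(\<lambda>n. b - e n) \<longlonglongrightarrow> b"
    using tendsto_diff_ennreal[OF tendsto_const assms(1), of b] assms(2) by simp
  show "(\<lambda>n. b + e n) \<longlonglongrightarrow> b"
    using tendsto_add[OF tendsto_const assms(1), of b] by simp
  show "eventually (\<lambda>n. b - e n \<le> a n) sequentially"
    using assms(4) by (intro always_eventually allI) (use assms(2) in \<open>auto simp: ennreal_minus_le_iff add.commute\<close>)
  show "eventually (\<lambda>n. a n \<le> b + e n) sequentially"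
    using assms(3) by (intro always_eventually allI)
qed

text \<open>In each coordinate the error is a tail of the series, dominated by the tail of the
  \<open>g i\<close> because the entries of \<open>y i\<close> are at most 1 in absolute value. An
  infinite tail sum makes the bound trivial.\<close>

lemma sup_nn_sums_tail_le:
  assumes "\<And>k. (\<lambda>i. g i * y i k) sums x k" "\<And>i. 0 \<le> g i" "\<And>i k. \<bar>y i k\<bar> \<le> 1"
  shows "sup_nn (\<lambda>k. (\<Sum>i<m. g i * y i k) - x k) \<le> (\<Sum>i. ennreal (g (i + m)))"
  unfolding sup_nn_le_iff
proof
  fix k
  show "ennreal \<bar>(\<Sum>i<m. g i * y i k) - x k\<bar> \<le> (\<Sum>i. ennreal (g (i + m)))"
  proof (cases "(\<Sum>i. ennreal (g (i + m))) = top")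
    case False
    then have sum_g: "summable (\<lambda>i. g (i + m))"
      using assms(2) by (intro summable_suminf_not_top) auto
    have le: "\<bar>g i * y i k\<bar> \<le> g i" for i
      using assms(2)[of i] assms(3)[of i k] by (simp add: abs_mult mult_left_le)
    have sum_abs: "summable (\<lambda>i. \<bar>g (i + m) * y (i + m) k\<bar>)"
      by (rule summable_comparison_test'[OF sum_g]) (use le in simp)
    have "(\<lambda>i. g (i + m) * y (i + m) k) sums (x k - (\<Sum>i<m. g i * y i k))"
      using assms(1) by (rule sums_split_initial_segment)
    then have "\<bar>(\<Sum>i<m. g i * y i k) - x k\<bar> = \<bar>\<Sum>i. g (i + m) * y (i + m) k\<bar>"
      by (simp add: sums_iff abs_minus_commute)
    also have "\<dots> \<le> (\<Sum>i. \<bar>g (i + m) * y (i + m) k\<bar>)"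
      using sum_abs by (rule summable_rabs)
    also have "\<dots> \<le> (\<Sum>i. g (i + m))"
      using le sum_abs sum_g by (intro suminf_le) auto
    finally have "ennreal \<bar>(\<Sum>i<m. g i * y i k) - x k\<bar> \<le> ennreal (\<Sum>i. g (i + m))"
      by (rule ennreal_leI)
    also have "\<dots> = (\<Sum>i. ennreal (g (i + m)))"
      using assms(2) sum_g by (intro suminf_ennreal2[symmetric]) auto
    finally show ?thesis .
  qed simp
qed

text \<open>The passage from finitely supported functions to tensors preserves distances, so Cauchy
  conditions transfer between the two norms.\<close>

lemma pnorm_diff_coord_tensor:
  fixes \<Gamma> :: "'g set"
  assumes "finitely_supported M K F" "finitely_supported M L G" "K \<subseteq> \<Gamma>" "L \<subseteq> \<Gamma>"
  shows "ennreal (vnorm (alg_tensor (L1 M) (c0 \<Gamma>))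
      (\<lambda>B. coord_tensor M \<Gamma> K F B - coord_tensor M \<Gamma> L G B)) =
    (\<integral>\<^sup>+t. sup_nn (\<lambda>k. F t k - G t k) \<partial>M)"
  using assms by (simp add: coord_tensor_diff pnorm_coord_tensor finitely_supported_diff)

text \<open>By density each member of a Cauchy sequence is replaced by a coordinate tensor with
  error below \<open>(1/2) ^ n\<close>; the new sequence is equivalent and defines the same
  class.\<close>

lemma proj_tensor_coordE:
  fixes M :: "'a measure" and \<Gamma> :: "'g set"
  assumes "u \<in> vcarrier (proj_tensor_product (L1 M) (c0 \<Gamma>))"
  obtains K F where "\<And>n. finitely_supported M (K n) (F n)" "\<And>n. K n \<subseteq> \<Gamma>"
    "(\<lambda>n. coord_tensor M \<Gamma> (K n) (F n)) \<in> cauchy_seqs (alg_tensor (L1 M) (c0 \<Gamma>))"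
    "u = cauchy_class (alg_tensor (L1 M) (c0 \<Gamma>)) (\<lambda>n. coord_tensor M \<Gamma> (K n) (F n))"
proof -
  let ?V = "alg_tensor (L1 M) (c0 \<Gamma>)"
  obtain s where s: "s \<in> cauchy_seqs ?V" "u = cauchy_class ?V s"
    using assms by (auto simp: L1_c0.P_eqs)
  have "\<exists>KF. finitely_supported M (fst KF) (snd KF) \<and> fst KF \<subseteq> \<Gamma> \<and>
      vnorm ?V (\<lambda>B. s n B - coord_tensor M \<Gamma> (fst KF) (snd KF) B) < (1/2) ^ n" for n
  proof -
    have "(0 :: real) < (1/2) ^ n" by simp
    then obtain K F where "finitely_supported M K F" "K \<subseteq> \<Gamma>"
      "vnorm ?V (\<lambda>B. s n B - coord_tensor M \<Gamma> K F B) < (1/2) ^ n"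
      by (rule approx_coord_tensor[OF L1_c0.cauchyD_Vc[OF s(1)]])
    then show ?thesis by (intro exI[of _ "(K, F)"]) simp
  qed
  then have "\<exists>KF. \<forall>n. finitely_supported M (fst (KF n)) (snd (KF n)) \<and> fst (KF n) \<subseteq> \<Gamma> \<and>
      vnorm ?V (\<lambda>B. s n B - coord_tensor M \<Gamma> (fst (KF n)) (snd (KF n)) B) < (1/2) ^ n"
    by (intro choice allI)
  then obtain KF where KF: "\<And>n. finitely_supported M (fst (KF n)) (snd (KF n))" "\<And>n. fst (KF n) \<subseteq> \<Gamma>"
      "\<And>n. vnorm ?V (\<lambda>B. s n B - coord_tensor M \<Gamma> (fst (KF n)) (snd (KF n)) B) < (1/2) ^ n"
    by blast
  let ?s' = "\<lambda>n. coord_tensor M \<Gamma> (fst (KF n)) (snd (KF n))"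
  have s': "?s' n \<in> vcarrier ?V" for n using KF by (intro coord_tensor_carrier)
  have "(\<lambda>n. (1/2 :: real) ^ n) \<longlonglongrightarrow> 0" by (rule LIMSEQ_power_zero) simp
  then have equiv: "L1_c0.equiv_seq M \<Gamma> s ?s'"
    by (rule L1_c0.equiv_seqI[OF L1_c0.cauchyD_Vc[OF s(1)] s' less_imp_le[OF KF(3)]])
  have "?s' \<in> cauchy_seqs ?V" by (rule L1_c0.cauchy_equiv[OF s(1) s' equiv])
  then show thesis
    using that[of "\<lambda>n. fst (KF n)" "\<lambda>n. snd (KF n)"] KF(1,2)
      L1_c0.cauchy_class_eqI[OF s(1) _ equiv] s(2) by blast
qed

lemma attains_proj_norm_L1_c0:
  fixes M :: "'a measure" and \<Gamma> :: "'g set"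
  assumes "u \<in> vcarrier (proj_tensor_product (L1 M) (c0 \<Gamma>))"
  shows "attains_proj_norm (L1 M) (c0 \<Gamma>) u"
proof -
  let ?V = "alg_tensor (L1 M) (c0 \<Gamma>)"
  let ?P = "proj_tensor_product (L1 M) (c0 \<Gamma>)"
  obtain K F where F: "\<And>n. finitely_supported M (K n) (F n)" and K: "\<And>n. K n \<subseteq> \<Gamma>"
    and cauchy: "(\<lambda>n. coord_tensor M \<Gamma> (K n) (F n)) \<in> cauchy_seqs ?V"
    and u: "u = cauchy_class ?V (\<lambda>n. coord_tensor M \<Gamma> (K n) (F n))"
    by (rule proj_tensor_coordE[OF assms]) (rule that; simp)
  have fin: "finite (K n)" and supp: "k \<notin> K n \<Longrightarrow> F n t k = 0"
    and meas: "(\<lambda>t. F n t k) \<in> borel_measurable M" for n t k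
    using F[of n] by (auto simp: finitely_supported_def)
  have cauchy_F: "\<exists>N. \<forall>m\<ge>N. \<forall>n\<ge>N. (\<integral>\<^sup>+t. sup_nn (\<lambda>k. F m t k - F n t k) \<partial>M) \<le> ennreal \<epsilon>"
    if pos: "0 < \<epsilon>" for \<epsilon>
  proof -
    obtain N where N: "\<forall>m\<ge>N. \<forall>n\<ge>N. vnorm ?V
        (\<lambda>B. coord_tensor M \<Gamma> (K m) (F m) B - coord_tensor M \<Gamma> (K n) (F n) B) < \<epsilon>"
      using L1_c0.cauchyD[OF cauchy pos] by blast
    have "(\<integral>\<^sup>+t. sup_nn (\<lambda>k. F m t k - F n t k) \<partial>M) \<le> ennreal \<epsilon>" if "m \<ge> N" "n \<ge> N" for m n
      unfolding pnorm_diff_coord_tensor[OF F F K K, symmetric]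
      using N that by (intro ennreal_leI less_imp_le) blast
    then show ?thesis by blast
  qed
  \<comment> \<open>\<open>G\<close> is the function with values in \<open>c0\<close> that
    \<open>u\<close> represents.\<close>
  obtain G where G_meas: "\<And>k. (\<lambda>t. G t k) \<in> borel_measurable M"
    and G_supp: "\<And>t k. k \<notin> (\<Union>n. K n) \<Longrightarrow> G t k = 0"
    and G_c0: "\<And>t \<epsilon>. 0 < \<epsilon> \<Longrightarrow> finite {k. \<epsilon> < \<bar>G t k\<bar>}"
    and lim: "(\<lambda>n. \<integral>\<^sup>+t. sup_nn (\<lambda>k. F n t k - G t k) \<partial>M) \<longlonglongrightarrow> 0"
    by (rule sup_nn_L1_complete[of K F M, OF fin supp meas cauchy_F]; (assumption | (rule that; simp)))
  have cK: "countable (\<Union>n. K n)" using fin by (simp add: countable_finite)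
  have KG: "(\<Union>n. K n) \<subseteq> \<Gamma>" using K by blast
  have triangle: "(\<integral>\<^sup>+t. sup_nn (\<lambda>k. A t k - C t k) \<partial>M) \<le>
      (\<integral>\<^sup>+t. sup_nn (\<lambda>k. A t k - B t k) \<partial>M) + (\<integral>\<^sup>+t. sup_nn (\<lambda>k. B t k - C t k) \<partial>M)"
    if "\<And>k. (\<lambda>t. A t k) \<in> borel_measurable M" "\<And>k. (\<lambda>t. B t k) \<in> borel_measurable M"
      "\<And>k. (\<lambda>t. C t k) \<in> borel_measurable M"
      "\<And>t k. k \<notin> (\<Union>n. K n) \<Longrightarrow> A t k = 0" "\<And>t k. k \<notin> (\<Union>n. K n) \<Longrightarrow> B t k = 0"
      "\<And>t k. k \<notin> (\<Union>n. K n) \<Longrightarrow> C t k = 0"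
    for A B C :: "'a \<Rightarrow> 'g \<Rightarrow> real"
  proof -
    have "(\<lambda>t. sup_nn (\<lambda>k. A t k - B t k)) \<in> borel_measurable M"
      by (rule sup_nn_measurable[OF cK]) (use that in auto)
    moreover have "(\<lambda>t. sup_nn (\<lambda>k. B t k - C t k)) \<in> borel_measurable M"
      by (rule sup_nn_measurable[OF cK]) (use that in auto)
    ultimately show ?thesis
      by (subst nn_integral_add[symmetric]) (auto intro!: nn_integral_mono sup_nn_triangle)
  qed
  have F_supp: "F n t k = 0" if "k \<notin> (\<Union>n. K n)" for n t k using that supp by blast
  \<comment> \<open>Distances to the approximants converge to the distance to \<open>G\<close>. With
    \<open>H = 0\<close> this gives the norm of \<open>u\<close>; with a partial sum as
    \<open>H\<close>, its distance to \<open>u\<close>.\<close>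
  have limH: "(\<lambda>n. \<integral>\<^sup>+t. sup_nn (\<lambda>k. H t k - F n t k) \<partial>M) \<longlonglongrightarrow> (\<integral>\<^sup>+t. sup_nn (\<lambda>k. H t k - G t k) \<partial>M)"
    if H: "\<And>k. (\<lambda>t. H t k) \<in> borel_measurable M" "\<And>t k. k \<notin> (\<Union>n. K n) \<Longrightarrow> H t k = 0"
      and H_fin: "(\<integral>\<^sup>+t. sup_nn (\<lambda>k. H t k - G t k) \<partial>M) < \<infinity>" for H
  proof (rule tendsto_ennreal_of_close[OF lim H_fin])
    show "(\<integral>\<^sup>+t. sup_nn (\<lambda>k. H t k - F n t k) \<partial>M) \<le>
        (\<integral>\<^sup>+t. sup_nn (\<lambda>k. H t k - G t k) \<partial>M) + (\<integral>\<^sup>+t. sup_nn (\<lambda>k. F n t k - G t k) \<partial>M)" for n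
      using triangle[of H G "F n"] H G_meas meas G_supp F_supp
      by (simp add: sup_nn_minus_commute[of "F n _" "G _"])
    show "(\<integral>\<^sup>+t. sup_nn (\<lambda>k. H t k - G t k) \<partial>M) \<le>
        (\<integral>\<^sup>+t. sup_nn (\<lambda>k. H t k - F n t k) \<partial>M) + (\<integral>\<^sup>+t. sup_nn (\<lambda>k. F n t k - G t k) \<partial>M)" for n
      using triangle[of H "F n" G] H G_meas meas G_supp F_supp by simp
  qed
  have neg: "sup_nn (\<lambda>k. 0 - x k) = sup_nn x" for x :: "'g \<Rightarrow> real" by (simp add: sup_nn_def)
  define I where "I = (\<integral>\<^sup>+t. sup_nn (G t) \<partial>M)"
  have I_fin: "I < \<infinity>"
  proof -
    \<comment> \<open>A single approximant at distance below 1 suffices, since its own integral is a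
      projective norm and hence finite.\<close>
    have "eventually (\<lambda>n. (\<integral>\<^sup>+t. sup_nn (\<lambda>k. F n t k - G t k) \<partial>M) < 1) sequentially"
      using lim by (rule order_tendstoD) simp
    then obtain n where n: "(\<integral>\<^sup>+t. sup_nn (\<lambda>k. F n t k - G t k) \<partial>M) < 1"
      by (auto simp: eventually_sequentially)
    have "I \<le> (\<integral>\<^sup>+t. sup_nn (F n t) \<partial>M) + (\<integral>\<^sup>+t. sup_nn (\<lambda>k. F n t k - G t k) \<partial>M)"
      using triangle[of "\<lambda>t k. 0" "F n" G] G_meas meas G_supp F_supp by (simp only: neg I_def) simp
    also have "\<dots> < \<infinity>"
      unfolding pnorm_coord_tensor[OF F K, symmetric] using n by (simp add: order_less_trans)
    finally show ?thesis .
  qed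
  have norm_u: "vnorm ?P u = enn2real I"
    unfolding u
  proof (rule L1_c0.vnorm_P_class[OF cauchy])
    have "(\<lambda>n. \<integral>\<^sup>+t. sup_nn (F n t) \<partial>M) \<longlonglongrightarrow> I"
      using limH[of "\<lambda>t k. 0"] I_fin by (simp only: neg I_def) simp
    then have "(\<lambda>n. enn2real (\<integral>\<^sup>+t. sup_nn (F n t) \<partial>M)) \<longlonglongrightarrow> enn2real I"
      using I_fin by (intro tendsto_enn2real) auto
    then show "(\<lambda>n. vnorm ?V (coord_tensor M \<Gamma> (K n) (F n))) \<longlonglongrightarrow> enn2real I"
      by (simp add: pnorm_coord_tensor[OF F K, symmetric] L1_c0.pnorm_nonneg coord_tensor_carrier[OF F K])
  qed
  show ?thesis
  proof (rule layer_cake_decomposition[OF cK G_meas G_supp G_c0])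
    fix g :: "nat \<Rightarrow> 'a \<Rightarrow> real" and y :: "nat \<Rightarrow> 'g \<Rightarrow> real"
    assume g_meas: "\<And>i. g i \<in> borel_measurable M" and g_nonneg: "\<And>i t. 0 \<le> g i t"
      and y: "\<And>i. y i \<in> sign_vectors (\<Union>n. K n)"
      and g_zero: "\<And>i t. y i = (\<lambda>k. 0) \<Longrightarrow> g i t = 0"
      and sums: "\<And>t k. t \<in> space M \<Longrightarrow> (\<lambda>i. g i t * y i k) sums G t k"
      and norm: "\<And>t. t \<in> space M \<Longrightarrow> (\<Sum>i. ennreal (g i t)) = sup_nn (G t)"
    have sum_I: "(\<Sum>i. \<integral>\<^sup>+t. ennreal (g i t) \<partial>M) = I"
      unfolding I_def using g_meas norm
      by (subst nn_integral_suminf[symmetric]) (auto intro!: nn_integral_cong)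
    have int_g: "integrable M (g i)" for i
    proof (rule integrableI_nonneg)
      have "(\<integral>\<^sup>+t. ennreal (g i t) \<partial>M) \<le> I"
        unfolding sum_I[symmetric] using sum_le_suminf[of "\<lambda>i. \<integral>\<^sup>+t. ennreal (g i t) \<partial>M" "{i}"] by simp
      then show "(\<integral>\<^sup>+t. ennreal (g i t) \<partial>M) < \<infinity>" using I_fin by (rule order_le_less_trans)
    qed (use g_meas g_nonneg in auto)
    \<comment> \<open>The \<open>L1\<close> norms of the \<open>g i\<close>; these will be the costs
      of the terms, and their sum is the norm of \<open>u\<close>.\<close>
    define c where "c i = (\<integral>t. g i t \<partial>M)" for i
    have c_nonneg: "0 \<le> c i" for i using g_nonneg by (simp add: c_def)
    have nn_c: "(\<integral>\<^sup>+t. ennreal (g i t) \<partial>M) = ennreal (c i)" for i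
      unfolding c_def using int_g g_nonneg by (intro nn_integral_eq_integral) auto
    have c_summable: "summable c"
      using c_nonneg I_fin sum_I by (intro summable_suminf_not_top) (auto simp: nn_c)
    have c_sums: "c sums enn2real I"
    proof -
      have "ennreal (suminf c) = I"
        using c_summable c_nonneg sum_I by (simp add: suminf_ennreal2[symmetric] nn_c)
      then have "suminf c = enn2real I" using c_summable c_nonneg
        by (metis enn2real_ennreal suminf_nonneg)
      then show ?thesis using c_summable by (simp add: sums_iff)
    qed
    define S where "S m t k = (\<Sum>i<m. g i t * y i k)" for m t k
    \<comment> \<open>A finite set carrying the first \<open>m\<close> vectors, so that each partial
      sum is a coordinate tensor.\<close>
    define L where "L m = (\<Union>i<m. {k. y i k \<noteq> 0})" for m :: nat
    have L: "finite (L m)" "L m \<subseteq> (\<Union>n. K n)" "L m \<subseteq> \<Gamma>" for m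
      using sign_vectorsD(1,2)[OF y] KG unfolding L_def by blast+
    have S: "finitely_supported M (L m) (S m)" for m
      unfolding finitely_supported_def
      using L int_g by (auto simp: S_def L_def intro!: sum.neutral)
    have partial: "(\<lambda>B. \<Sum>i<m. elem_tensor (L1 M) (c0 \<Gamma>) (L1_class M (g i)) (y i) B) =
        coord_tensor M \<Gamma> (L m) (S m)" for m
      unfolding S_def using L int_g by (intro sum_elem_tensor_eq_coord) (auto simp: L_def)
    have y_le: "\<bar>y i k\<bar> \<le> 1" for i k using sign_vectorsD(3)[OF y, of i k] by auto
    have y_c0: "y i \<in> vcarrier (c0 \<Gamma>)" for i by (rule sign_vector_c0[OF y KG])
    have tail: "(\<integral>\<^sup>+t. sup_nn (\<lambda>k. S m t k - G t k) \<partial>M) \<le> ennreal (\<Sum>i. c (i + m))" for m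
    proof -
      have "(\<integral>\<^sup>+t. sup_nn (\<lambda>k. S m t k - G t k) \<partial>M) \<le> (\<integral>\<^sup>+t. (\<Sum>i. ennreal (g (i + m) t)) \<partial>M)"
        unfolding S_def using sums g_nonneg y_le
        by (intro nn_integral_mono sup_nn_sums_tail_le) auto
      also have "\<dots> = (\<Sum>i. ennreal (c (i + m)))"
        using g_meas by (subst nn_integral_suminf) (auto simp: nn_c)
      also have "\<dots> = ennreal (\<Sum>i. c (i + m))"
        using c_summable c_nonneg by (intro suminf_ennreal2) (auto simp: summable_iff_shift)
      finally show ?thesis .
    qed
    have tail_lim: "(\<lambda>m. \<Sum>i. c (i + m)) \<longlonglongrightarrow> 0"
    proof -
      have "(\<lambda>m. suminf c - (\<Sum>i<m. c i)) \<longlonglongrightarrow> suminf c - suminf c"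
        using summable_LIMSEQ[OF c_summable] by (intro tendsto_diff tendsto_const)
      then show ?thesis using c_summable by (simp add: suminf_minus_initial_segment)
    qed
    \<comment> \<open>The partial sum is the class of a constant sequence, so its distance to
      \<open>u\<close> is a limit of distances to the approximants.\<close>
    have vdist: "vdist ?P (vsum ?P (\<lambda>i. proj_elem_tensor (L1 M) (c0 \<Gamma>) (L1_class M (g i)) (y i)) m) u =
        enn2real (\<integral>\<^sup>+t. sup_nn (\<lambda>k. S m t k - G t k) \<partial>M)" for m
    proof -
      have D_fin: "(\<integral>\<^sup>+t. sup_nn (\<lambda>k. S m t k - G t k) \<partial>M) < \<infinity>"
        using tail[of m] by (rule order_le_less_trans) simp
      have S_supp: "S m t k = 0" if "k \<notin> (\<Union>n. K n)" for t k
        using S[of m] L(2)[of m] that by (auto simp: finitely_supported_def)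
      have S_meas: "(\<lambda>t. S m t k) \<in> borel_measurable M" for k
        using S[of m] by (auto simp: finitely_supported_def)
      have "(\<lambda>n. enn2real (\<integral>\<^sup>+t. sup_nn (\<lambda>k. S m t k - F n t k) \<partial>M)) \<longlonglongrightarrow>
          enn2real (\<integral>\<^sup>+t. sup_nn (\<lambda>k. S m t k - G t k) \<partial>M)"
        using limH[OF S_meas S_supp D_fin] D_fin by (intro tendsto_enn2real) auto
      then have "(\<lambda>n. vnorm ?V (\<lambda>B. coord_tensor M \<Gamma> (L m) (S m) B - coord_tensor M \<Gamma> (K n) (F n) B)) \<longlonglongrightarrow>
          enn2real (\<integral>\<^sup>+t. sup_nn (\<lambda>k. S m t k - G t k) \<partial>M)"
        by (simp add: pnorm_diff_coord_tensor[OF S F L(3) K, symmetric] L1_c0.pnorm_nonneg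
            L1_c0.diff_Vc coord_tensor_carrier[OF F K] coord_tensor_carrier[OF S L(3)])
      then show ?thesis
        unfolding L1_c0.vsum_P_elem[OF L1_class_carrier[OF int_g] y_c0] partial u
        by (intro L1_c0.vdist_P_class cauchy L1_c0.cauchy_const coord_tensor_carrier[OF S L(3)])
    qed
    show "attains_proj_norm (L1 M) (c0 \<Gamma>) u"
      unfolding attains_proj_norm_def
    proof (intro exI conjI allI)
      show "L1_class M (g i) \<in> vcarrier (L1 M)" for i by (rule L1_class_carrier[OF int_g])
      show "y i \<in> vcarrier (c0 \<Gamma>)" for i by (rule y_c0)
      show "vsums ?P (\<lambda>i. proj_elem_tensor (L1 M) (c0 \<Gamma>) (L1_class M (g i)) (y i)) u"
        unfolding vsums_def vdist
      proof (rule tendsto_sandwich[OF _ _ tendsto_const tail_lim])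
        have "0 \<le> (\<Sum>i. c (i + m))" for m
          using c_summable c_nonneg by (intro suminf_nonneg) (auto simp: summable_iff_shift)
        then have "enn2real (\<integral>\<^sup>+t. sup_nn (\<lambda>k. S m t k - G t k) \<partial>M) \<le> (\<Sum>i. c (i + m))" for m
          using tail[of m] by (intro enn2real_leI)
        then show "eventually (\<lambda>m. enn2real (\<integral>\<^sup>+t. sup_nn (\<lambda>k. S m t k - G t k) \<partial>M) \<le> (\<Sum>i. c (i + m))) sequentially"
          by (intro always_eventually allI)
      qed simp
      have "vnorm (L1 M) (L1_class M (g i)) * vnorm (c0 \<Gamma>) (y i) = c i" for i
      \<comment> \<open>A zero vector has norm 0 instead of 1, but then \<open>g i\<close> vanishes,
        so the cost is \<open>c i\<close> in both cases.\<close>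
      proof (cases "y i = (\<lambda>k. 0)")
        case True
        then show ?thesis using g_zero[OF True] by (simp add: L1_norm_class[OF int_g] c_def)
      next
        case False
        then show ?thesis
          using sign_vector_norm[OF y KG False] g_nonneg by (simp add: L1_norm_class[OF int_g] c_def)
      qed
      then show "(\<lambda>i. vnorm (L1 M) (L1_class M (g i)) * vnorm (c0 \<Gamma>) (y i)) sums vnorm ?P u"
        using c_sums norm_u by simp
    qed
  qed
qed

theorem corollary5p12:
  fixes M :: "'a measure" and \<Gamma> :: "'g set"
  shows "NA_proj (L1 M) (c0 \<Gamma>) = vcarrier (proj_tensor_product (L1 M) (c0 \<Gamma>))"
  unfolding NA_proj_def using attains_proj_norm_L1_c0 by blast

end
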